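(* Assume that the equation $(I-A)x^s-Bu^s=E\mu_W+z$ has a solution $(x^s,u^s)\in\mathbb{R}^n\times\mathbb{R}^l$ and that $(A,Q_1^{1/2})$ is detectable. Let $K$, $(\tilde x^s_\star,\tilde u^s_\star)$ and the distribution $\varrho_X^{s,\star}$ be as fixed in the context. Then $\varrho_X^{s,\star}$ together with the feedback $\pi^*(X)=K(X-\tilde x^s_\star-x^s)+\tilde u^s_\star+u^s$ is a solution of the optimization problem $$\begin{aligned}&\min_{\pi,\varrho_X}\ \ell(X,U)\\ &\text{s.t. there exist independent } X\in L^2(\Omega,\mathcal{F},\mathbb{P};\mathbb{R}^n),\ X\sim\varrho_X,\ \text{ and } W\in L^2(\Omega,\mathcal{F},\mathbb{P};\mathbb{R}^m),\ W\sim\varrho_W,\\ &\text{such that } f(X,U,W)\sim\varrho_X \text{ with } U=\pi\circ X,\ \pi\in\mathbb{F}(\mathbb{R}^n,\mathbb{R}^l).\end{aligned}$$ Further, the stationary distribution $\varrho_X^{s,\star}\in\mathcal{P}_2(\mathbb{R}^n)$ is the unique (partial) solution of this problem, i.e., for every other solution $(\bar\varrho_X^s,\bar\pi)\in\mathcal{P}_2(\mathbb{R}^n)\times\mathbb{F}(\mathbb{R}^n,\mathbb{R}^l)$ of this problem one has $\bar\varrho_X^s=\varrho_X^{s,\star}$.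
   Context: Setting. Let $A\in\mathbb{R}^{n\times n}$, $B\in\mathbb{R}^{n\times l}$ with $(A,B)$ stabilizable, $E\in\mathbb{R}^{n\times m}$, $z\in\mathbb{R}^n$. Let $(\Omega,\mathcal{F},\mathbb{P})$ be a probability space and $\{W(k)\}_{k\in\mathbb{N}_0}\subset L^2(\Omega,\mathcal{F},\mathbb{P};\mathbb{R}^m)$ a fixed i.i.d. sequence with common (not necessarily Gaussian) distribution $\varrho_W$, mean $\mu_W$ and covariance $\Sigma_W$. The stochastic system is $$X(k+1)=f(X(k),U(k),W(k)):=AX(k)+BU(k)+EW(k)+z,\quad X(0)=X_0,$$ where $X(k)\in L^2(\Omega,\mathcal{F}_k,\mathbb{P};\mathbb{R}^n)$, $U(k)\in L^2(\Omega,\mathcal{F}_k,\mathbb{P};\mathbb{R}^l)$, $\mathcal{F}_k=\sigma(X(0),\dots,X(k))$ is the natural filtration of the state process, and $W(k)$ is independent of $X(k)$ and $U(k)$ for every $k$. These standing assumptions apply to every state/control process considered (including stationary ones) and to every $(X(k),U(k))$ in statements quantified over such pairs. Stage cost: $$\ell(X,U):=\mathbb{E}\big[X^TQ_1X+U^TR_1U+r^TX+v^TU+c\big]+\mathrm{Tr}\big(Q_2\mathrm{Cov}(X)+R_2\mathrm{Cov}(U)\big),$$ with symmetric $Q_1,Q_2\in\mathbb{R}^{n\times n}$, $R_1,R_2\in\mathbb{R}^{l\times l}$, $Q_1,Q_2,R_2\ge 0$, $R_1>0$, $r\in\mathbb{R}^n$, $v\in\mathbb{R}^l$, $c\in\mathbb{R}$.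 For $U=\pi\circ X$ the value $\ell(X,U)$ depends only on the law of $X$ and on $\pi$. For $M\ge0$, $\|x\|_M:=\sqrt{x^TMx}$; $\|\cdot\|$ is the Euclidean norm. Deterministic vectors are regarded as constant random variables. $\mathcal{K}_\infty$ is the set of continuous, strictly increasing, unbounded $\alpha:[0,\infty)\to[0,\infty)$ with $\alpha(0)=0$. $\mathcal{P}_2(\mathcal{X})$ is the set of probability measures on $\mathcal{X}$ with finite second moment; two elements are identified when their Wasserstein distance of order 2 is zero, i.e. when they are equal as measures. $\mathbb{F}(\mathbb{R}^n,\mathbb{R}^l)$ is the set of measurable maps $\pi:\mathbb{R}^n\to\mathbb{R}^l$ with $\pi\circ X\in L^2(\Omega,\mathcal{F}_k,\mathbb{P};\mathbb{R}^l)$ for each $X\in L^2(\Omega,\mathcal{F}_k,\mathbb{P};\mathbb{R}^n)$. Data. Under the assumptions of the claim, fix a solution $(x^s,u^s)$ and the following objects (all of which exist). $P$ is the positive semidefinite solution of $P=A^TPA+(Q_1+Q_2)-A^TPB[(R_1+R_2)+B^TPB]^{-1}B^TPA$ and $K:=-[(R_1+R_2)+B^TPB]^{-1}B^TPA$. Put $\hat W(k):=W(k)-\mu_W$, $\hat r:=r+2Q_1x^s$, $\hat v:=v+2R_1u^s$, $\hat c:=(x^s)^TQ_1x^s+(u^s)^TR_1u^s+r^Tx^s+v^Tu^s+c$ and $$\hat\ell(X,U):=\mathbb{E}[X^TQ_1X+U^TR_1U+\hat r^TX+\hat v^TU+\hat c]+\mathrm{Tr}(Q_2\mathrm{Cov}(X)+R_2\mathrm{Cov}(U)).$$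 $\hat X^s(\cdot)$ is the process $\hat X^s(k+1)=A\hat X^s(k)+B\hat U^s(k)+E\hat W(k)$, $\hat U^s(k)=K\hat X^s(k)$, with $\hat X^s(k)\sim\hat\varrho_X^s\in\mathcal{P}_2(\mathbb{R}^n)$ for all $k$ ($\hat\varrho_X^s$ an invariant distribution, with zero mean). Further, $(\tilde x^s_\star,\tilde u^s_\star)$ is a solution of $(I-A)x-Bu=0$, $\alpha\in\mathcal{K}_\infty$, $S\in\mathbb{R}^{n\times n}$ is symmetric positive definite and $q\in\mathbb{R}^n$, such that, with $\tilde X(k):=X(k)-x^s-\hat X^s(k)$, $\tilde U(k):=U(k)-u^s-\hat U^s(k)$, $\tilde X(k+1):=A\tilde X(k)+B\tilde U(k)$ and $\tilde\lambda(Y):=\mathbb{E}[\|Y\|_S^2+q^TY]$, the inequality $$\hat\ell(\tilde X(k),\tilde U(k))-\hat\ell(\tilde x^s_\star,\tilde u^s_\star)+\tilde\lambda(\tilde X(k))-\tilde\lambda(\tilde X(k+1))\ge\alpha\big(\mathbb{E}[\|\tilde X(k)-\tilde x^s_\star\|^2]\big)$$ holds for all $k\in\mathbb{N}_0$ and all $(X(k),U(k))\in L^2(\Omega,\mathcal{F}_k,\mathbb{P};\mathbb{R}^n)\times L^2(\Omega,\mathcal{F}_k,\mathbb{P};\mathbb{R}^l)$. The stationary pair $(X^s_\star(\cdot),U^s_\star(\cdot))$ is defined by $X^s_\star(0)=\hat X^s(0)+x^s+\tilde x^s_\star$, $X^s_\star(k+1)=f(X^s_\star(k),U^s_\star(k),W(k))$,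 $U^s_\star(k)=K(X^s_\star(k)-\tilde x^s_\star-x^s)+\tilde u^s_\star+u^s$; the law of $X^s_\star(k)$ is independent of $k$ and denoted $\varrho_X^{s,\star}\in\mathcal{P}_2(\mathbb{R}^n)$. *)

theory Defs
  imports "HOL-Probability.Probability"
begin

definition psd :: "real^'n^'n \<Rightarrow> bool" where
  "psd M \<longleftrightarrow> transpose M = M \<and> (\<forall>x. 0 \<le> x \<bullet> (M *v x))"

definition pos_def :: "real^'n^'n \<Rightarrow> bool" where
  "pos_def M \<longleftrightarrow> transpose M = M \<and> (\<forall>x. x \<noteq> 0 \<longrightarrow> 0 < x \<bullet> (M *v x))"

definition complex_matrix :: "real^'n^'m \<Rightarrow> complex^'n^'m" where
  "complex_matrix M = (\<chi> i j. complex_of_real (M $ i $ j))"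

text \<open>All complex eigenvalues lie in the open unit disc (discrete time).\<close>

definition schur_stable :: "real^'n^'n \<Rightarrow> bool" where
  "schur_stable M \<longleftrightarrow>
     (\<forall>\<mu> x. x \<noteq> 0 \<and> complex_matrix M *v x = \<mu> *s x \<longrightarrow> cmod \<mu> < 1)"

definition stabilizable :: "real^'n^'n \<Rightarrow> real^'l^'n \<Rightarrow> bool" where
  "stabilizable A B \<longleftrightarrow> (\<exists>F :: real^'n^'l. schur_stable (A + B ** F))"

definition detectable :: "real^'n^'n \<Rightarrow> real^'n^'p \<Rightarrow> bool" where
  "detectable A C \<longleftrightarrow> (\<exists>L :: real^'p^'n. schur_stable (A + L ** C))"

definition class_K_inf :: "(real \<Rightarrow> real) \<Rightarrow> bool" where
  "class_K_inf \<alpha> \<longleftrightarrow> continuous_on {0..} \<alpha> \<and> strict_mono_on {0..} \<alpha> \<and> \<alpha> 0 = 0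
     \<and> (\<forall>y. \<exists>x\<ge>0. y < \<alpha> x)"

text \<open>
  Square-integrable random variables (representatives) that are measurable with respect to a
  sub-sigma-algebra \<open>G\<close> of \<open>M\<close>.  The set is empty if \<open>G\<close> is not a sub-sigma-algebra of \<open>M\<close>.
\<close>

definition L2 :: "'w measure \<Rightarrow> 'w measure \<Rightarrow> ('w \<Rightarrow> 'b::euclidean_space) set" where
  "L2 M G = {X. subalgebra M G \<and> X \<in> borel_measurable G \<and> integrable M (\<lambda>\<omega>. (norm (X \<omega>))\<^sup>2)}"

definition P2 :: "'b::euclidean_space measure set" where
  "P2 = {\<rho>. prob_space \<rho> \<and> sets \<rho> = sets borel \<and> integrable \<rho> (\<lambda>x. (norm x)\<^sup>2)}"

text \<open>
  Independence is expressed through the generated sigma-algebras because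
  \<^const>\<open>prob_space.indep_var\<close> forces both random variables to have the same codomain type.
\<close>

definition indep_rvs ::
  "'w measure \<Rightarrow> ('w \<Rightarrow> 'a::topological_space) \<Rightarrow> ('w \<Rightarrow> 'b::topological_space) \<Rightarrow> bool" where
  "indep_rvs M X Y \<longleftrightarrow> prob_space.indep_set M
     (sets (vimage_algebra (space M) X borel)) (sets (vimage_algebra (space M) Y borel))"

definition natural_filtration ::
  "'w measure \<Rightarrow> (nat \<Rightarrow> 'w \<Rightarrow> 'b::topological_space) \<Rightarrow> nat \<Rightarrow> 'w measure" where
  "natural_filtration M X k =
     sigma (space M) (\<Union>i\<in>{..k}. sets (vimage_algebra (space M) (X i) borel))"

definition cov_matrix :: "'w measure \<Rightarrow> ('w \<Rightarrow> real^'n) \<Rightarrow> real^'n^'n" where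
  "cov_matrix M X = (\<chi> i j.
     \<integral>\<omega>. (X \<omega> $ i - (\<integral>\<omega>'. X \<omega>' $ i \<partial>M)) * (X \<omega> $ j - (\<integral>\<omega>'. X \<omega>' $ j \<partial>M)) \<partial>M)"

definition dynamics ::
  "real^'n^'n \<Rightarrow> real^'l^'n \<Rightarrow> real^'m^'n \<Rightarrow> real^'n \<Rightarrow> real^'n \<Rightarrow> real^'l \<Rightarrow> real^'m \<Rightarrow> real^'n" where
  "dynamics A B E z x u w = A *v x + B *v u + E *v w + z"

text \<open>
  State/control pairs satisfying the standing assumptions for the system \<open>f\<close> driven by \<open>W\<close>.
  Membership of \<open>X k\<close> in the \<open>L2\<close> space of its own natural filtration says that \<open>X k\<close> is a
  square-integrable random variable on \<open>M\<close>.  As elements of \<open>L2\<close> are identified almost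
  surely, the system equation is required almost surely.
\<close>

definition admissible_process ::
  "'w measure \<Rightarrow> (real^'n \<Rightarrow> real^'l \<Rightarrow> real^'m \<Rightarrow> real^'n) \<Rightarrow> (nat \<Rightarrow> 'w \<Rightarrow> real^'m) \<Rightarrow>
   (nat \<Rightarrow> 'w \<Rightarrow> real^'n) \<Rightarrow> (nat \<Rightarrow> 'w \<Rightarrow> real^'l) \<Rightarrow> bool" where
  "admissible_process M f W X U \<longleftrightarrow>
     (\<forall>k. X k \<in> L2 M (natural_filtration M X k)
        \<and> U k \<in> L2 M (natural_filtration M X k)
        \<and> indep_rvs M (W k) (\<lambda>\<omega>. (X k \<omega>, U k \<omega>))
        \<and> (AE \<omega> in M. X (Suc k) \<omega> = f (X k \<omega>) (U k \<omega>) (W k \<omega>)))"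

text \<open>
  The two covariance terms have different dimensions (\<open>n\<close> and \<open>l\<close>), so
  \<open>Tr(Q2 Cov(X) + R2 Cov(U))\<close> is the sum of the two traces.
\<close>

definition stage_cost ::
  "'w measure \<Rightarrow> real^'n^'n \<Rightarrow> real^'n^'n \<Rightarrow> real^'l^'l \<Rightarrow> real^'l^'l \<Rightarrow> real^'n \<Rightarrow> real^'l \<Rightarrow> real \<Rightarrow>
   ('w \<Rightarrow> real^'n) \<Rightarrow> ('w \<Rightarrow> real^'l) \<Rightarrow> real" where
  "stage_cost M Q1 Q2 R1 R2 r v c X U =
     (\<integral>\<omega>. X \<omega> \<bullet> (Q1 *v X \<omega>) + U \<omega> \<bullet> (R1 *v U \<omega>) + r \<bullet> X \<omega> + v \<bullet> U \<omega> + c \<partial>M)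
     + trace (Q2 ** cov_matrix M X) + trace (R2 ** cov_matrix M U)"

definition storage :: "'w measure \<Rightarrow> real^'n^'n \<Rightarrow> real^'n \<Rightarrow> ('w \<Rightarrow> real^'n) \<Rightarrow> real" where
  "storage M S q Y = (\<integral>\<omega>. Y \<omega> \<bullet> (S *v Y \<omega>) + q \<bullet> Y \<omega> \<partial>M)"

text \<open>
  The sigma-algebra in the definition of the feedback class is taken to be an arbitrary
  sub-sigma-algebra \<open>G\<close>; the largest one, \<open>G = M\<close>, covers all square-integrable random variables.
\<close>

definition feedbacks :: "'w measure \<Rightarrow> (real^'n \<Rightarrow> real^'l) set" where
  "feedbacks M = {\<pi>. \<pi> \<in> borel_measurable borel \<and> (\<forall>G. \<forall>X\<in>L2 M G. \<pi> \<circ> X \<in> L2 M G)}"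

definition stationary_witness ::
  "'w measure \<Rightarrow> (real^'n \<Rightarrow> real^'l \<Rightarrow> real^'m \<Rightarrow> real^'n) \<Rightarrow> (real^'m) measure \<Rightarrow>
   (real^'n) measure \<Rightarrow> (real^'n \<Rightarrow> real^'l) \<Rightarrow> ('w \<Rightarrow> real^'n) \<Rightarrow> ('w \<Rightarrow> real^'m) \<Rightarrow> bool" where
  "stationary_witness M f \<rho>W \<rho> \<pi> X W \<longleftrightarrow>
     X \<in> L2 M M \<and> W \<in> L2 M M \<and> indep_rvs M X W
     \<and> distr M borel X = \<rho> \<and> distr M borel W = \<rho>W
     \<and> distr M borel (\<lambda>\<omega>. f (X \<omega>) ((\<pi> \<circ> X) \<omega>) (W \<omega>)) = \<rho>"

definition stationary_feasible ::
  "'w measure \<Rightarrow> (real^'n \<Rightarrow> real^'l \<Rightarrow> real^'m \<Rightarrow> real^'n) \<Rightarrow> (real^'m) measure \<Rightarrow>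
   (real^'n) measure \<Rightarrow> (real^'n \<Rightarrow> real^'l) \<Rightarrow> bool" where
  "stationary_feasible M f \<rho>W \<rho> \<pi> \<longleftrightarrow>
     \<rho> \<in> P2 \<and> \<pi> \<in> feedbacks M \<and> (\<exists>X W. stationary_witness M f \<rho>W \<rho> \<pi> X W)"

text \<open>
  Solutions \<open>(\<rho>, \<pi>)\<close> of the stationary optimization problem.  The cost \<open>cost X (\<pi> \<circ> X)\<close> depends
  only on the law of \<open>X\<close> and on \<open>\<pi>\<close>, so it does not matter which witnesses are compared.
\<close>

definition stationary_solution ::
  "'w measure \<Rightarrow> (real^'n \<Rightarrow> real^'l \<Rightarrow> real^'m \<Rightarrow> real^'n) \<Rightarrow> (real^'m) measure \<Rightarrow>
   (('w \<Rightarrow> real^'n) \<Rightarrow> ('w \<Rightarrow> real^'l) \<Rightarrow> real) \<Rightarrow>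
   (real^'n) measure \<Rightarrow> (real^'n \<Rightarrow> real^'l) \<Rightarrow> bool" where
  "stationary_solution M f \<rho>W cost \<rho> \<pi> \<longleftrightarrow>
     stationary_feasible M f \<rho>W \<rho> \<pi>
     \<and> (\<forall>\<rho>' \<pi>' X W X' W'.
          stationary_witness M f \<rho>W \<rho> \<pi> X W
          \<and> stationary_feasible M f \<rho>W \<rho>' \<pi>' \<and> stationary_witness M f \<rho>W \<rho>' \<pi>' X' W'
          \<longrightarrow> cost X (\<pi> \<circ> X) \<le> cost X' (\<pi>' \<circ> X'))"

end

theory Submission
  imports Defs
begin

text \<open>
  Write \<open>X = x + X'\<close> and \<open>U = u + U'\<close> with \<open>x\<close>, \<open>u\<close> the expectations, and let \<open>N\<close> be \<open>E\<close> applied to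
  the centred noise; \<open>\<E>[\<dots>]\<close> is the expectation.  The stage cost is the sum of a cost of the means
  and a quadratic cost of the fluctuations with weights \<open>Q1 + Q2\<close> and \<open>R1 + R2\<close>
  (\<open>stage_cost_mean_fluctuation\<close>), and the two parts can be bounded from below separately.

  Fluctuations: stationarity and independence give
  \<open>\<E>[X' \<bullet> P X'] = \<E>[(A X' + B U') \<bullet> P (A X' + B U')] + \<E>[N \<bullet> P N]\<close>.  Completing the square with the
  Riccati equation turns this balance into the exact formula
  \<open>\<E>[N \<bullet> P N] + \<E>[(U' - K X') \<bullet> G (U' - K X')]\<close> for the fluctuation cost, where
  \<open>G = R1 + R2 + B\<^sup>T P B\<close> is positive definite (\<open>stationary_cost\<close>).  The first term depends only on
  the law of the noise, and the second vanishes exactly when \<open>U' = K X'\<close> almost surely.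

  Means: the pair of means is a steady state of the averaged system.  Shifting the process
  \<open>X_hat\<close> by a deterministic trajectory makes the tilde variables in the dissipation inequality
  deterministic (\<open>dissipativity_deterministic\<close>).  At a steady state the storage terms cancel, and
  what remains says that \<open>(xs + xt, us + ut)\<close> minimises the mean cost and that every minimiser has
  state component \<open>xs + xt\<close>.

  The candidate attains both minima.  Conversely, any solution has mean \<open>xs + xt\<close>, and its
  fluctuation follows the recursion \<open>Y \<mapsto> (A + B K) Y + N\<close>, as \<open>X_hat\<close> does.  So it remains to see
  that this recursion has only one invariant law.  The quadratic part of the dissipation
  inequality (\<open>dissipativity_strict_quadratic\<close>), added to the Riccati identity, makes \<open>S + P\<close> a
  strict Lyapunov matrix for \<open>A + B K\<close>, so the powers of \<open>A + B K\<close> decay geometrically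
  (\<open>strict_lyapunov_decay\<close>).  The transition operator then shrinks Lipschitz constants to zero,
  and two invariant laws give the same integral to every bounded Lipschitz function
  (\<open>invariant_law_unique\<close>).
\<close>

section \<open>Quadratic forms and the Riccati equation\<close>

lemma inner_vector_matrix_mult: "x \<bullet> (y v* M) = (M *v x) \<bullet> y"
  for M :: "real^'n^'m"
  by (metis dot_lmul_matrix inner_commute)

lemma symmetric_matrix_inner:
  fixes T :: "real^'n^'n"
  assumes "transpose T = T"
  shows "x \<bullet> (T *v y) = y \<bullet> (T *v x)"
  using inner_vector_matrix_mult[of y x T] assms
  by (metis inner_commute vector_transpose_matrix)

lemma minus_matrix_vector_mult: "(- F) *v x = - (F *v x)" for F :: "real^'n^'m"
  by (simp add: matrix_vector_mult_def vec_eq_iff sum_negf)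

lemma matrix_vector_mult_minus: "F *v (- x) = - (F *v x)" for F :: "real^'n^'m"
  by (simp add: matrix_vector_mult_def vec_eq_iff sum_negf)

lemma pos_def_add_psd:
  assumes "pos_def V" "psd T"
  shows "pos_def (V + T)"
  using assms unfolding pos_def_def psd_def
  by (auto simp: transpose_def vec_eq_iff matrix_vector_mult_add_rdistrib inner_add_right
      intro!: add_pos_nonneg)

text \<open>
  Averaging over \<open>\<plusminus>y\<close> isolates the quadratic part of a quadratic function in the direction \<open>y\<close>.
\<close>

lemma quadratic_form_symmetrize:
  fixes M :: "real^'n^'n"
  shows "(x + y) \<bullet> (M *v (x + y)) + (x - y) \<bullet> (M *v (x - y)) = 2 * (x \<bullet> (M *v x)) + 2 * (y \<bullet> (M *v y))"
  by (simp add: matrix_vector_right_distrib matrix_vector_mult_diff_distrib inner_add inner_diff)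

text \<open>
  The form attains its minimum on the unit sphere, and homogeneity carries the bound to all vectors.
\<close>

lemma quadratic_form_coercive:
  fixes V :: "real^'n^'n"
  assumes "\<And>y. y \<noteq> 0 \<Longrightarrow> 0 < y \<bullet> (V *v y)"
  obtains c where "0 < c" "\<And>y. c * (norm y)\<^sup>2 \<le> y \<bullet> (V *v y)"
proof -
  have cont: "continuous_on (sphere 0 1) (\<lambda>y::real^'n. y \<bullet> (V *v y))"
    by (intro continuous_intros linear_continuous_on matrix_vector_mul_bounded_linear)
  have ne: "sphere 0 1 \<noteq> ({} :: (real^'n) set)" by simp
  obtain y0 where y0: "y0 \<in> sphere 0 1" "\<And>y. y \<in> sphere 0 1 \<Longrightarrow> y0 \<bullet> (V *v y0) \<le> y \<bullet> (V *v y)"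
    using continuous_attains_inf[OF compact_sphere ne cont] by blast
  show ?thesis
  proof
    show "0 < y0 \<bullet> (V *v y0)" using y0(1) by (intro assms) auto
    show "y0 \<bullet> (V *v y0) * (norm y)\<^sup>2 \<le> y \<bullet> (V *v y)" for y
    proof (cases "y = 0")
      case False
      let ?e = "(1 / norm y) *\<^sub>R y"
      have "y0 \<bullet> (V *v y0) \<le> ?e \<bullet> (V *v ?e)"
        using False by (intro y0(2)) auto
      also have "\<dots> = (y \<bullet> (V *v y)) / (norm y)\<^sup>2"
        by (simp add: matrix_vector_mult_scaleR power2_eq_square)
      finally show ?thesis using False by (simp add: field_simps)
    qed simp
  qed
qed

lemma quadratic_form_bounded:
  fixes V :: "real^'n^'n"
  obtains c where "0 < c" "\<And>y. y \<bullet> (V *v y) \<le> c * (norm y)\<^sup>2"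
proof
  show "0 < onorm ((*v) V) + 1"
    by (simp add: onorm_pos_le add_nonneg_pos)
  fix y :: "real^'n"
  have "y \<bullet> (V *v y) \<le> norm y * norm (V *v y)" by (rule norm_cauchy_schwarz)
  also have "\<dots> \<le> norm y * (onorm ((*v) V) * norm y)"
    by (intro mult_left_mono onorm) auto
  also have "\<dots> \<le> (onorm ((*v) V) + 1) * (norm y)\<^sup>2"
    by (simp add: power2_eq_square algebra_simps)
  finally show "y \<bullet> (V *v y) \<le> (onorm ((*v) V) + 1) * (norm y)\<^sup>2" .
qed

lemma riccati_weight_pos:
  fixes P :: "real^'n^'n" and B :: "real^'l^'n" and R :: "real^'l^'l"
  assumes "pos_def R" "psd P" "w \<noteq> 0"
  shows "0 < w \<bullet> ((R + transpose B ** P ** B) *v w)"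
  using assms
  by (simp add: matrix_vector_mult_add_rdistrib inner_add_right inner_vector_matrix_mult
      pos_def_def psd_def add_pos_nonneg flip: matrix_vector_mul_assoc)

text \<open>
  The input \<open>K x\<close> minimises the left-hand side in \<open>u\<close>: by definition
  \<open>G K = - B\<^sup>T P A\<close>, and this cancels the mixed terms.  The Riccati equation says that the
  minimum is \<open>x \<bullet> P x\<close>.
\<close>

lemma riccati_complete_square:
  fixes A P Q :: "real^'n^'n" and B :: "real^'l^'n" and R :: "real^'l^'l"
  defines "G \<equiv> R + transpose B ** P ** B"
  assumes R: "pos_def R" and P_psd: "psd P"
    and P: "P = transpose A ** P ** A + Q
      - transpose A ** P ** B ** matrix_inv G ** transpose B ** P ** A"
    and K: "K = - (matrix_inv G ** transpose B ** P ** A)"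
  shows "x \<bullet> (Q *v x) + u \<bullet> (R *v u) + (A *v x + B *v u) \<bullet> (P *v (A *v x + B *v u))
      = x \<bullet> (P *v x) + (u - K *v x) \<bullet> (G *v (u - K *v x))"
proof -
  have sym: "a \<bullet> (P *v b) = b \<bullet> (P *v a)" for a b
    using P_psd by (intro symmetric_matrix_inner) (simp add: psd_def)
  have symR: "a \<bullet> (R *v b) = b \<bullet> (R *v a)" for a b
    using R by (intro symmetric_matrix_inner) (simp add: pos_def_def)
  have G: "a \<bullet> (G *v b) = a \<bullet> (R *v b) + (B *v a) \<bullet> (P *v (B *v b))" for a b
    by (simp add: G_def matrix_vector_mult_add_rdistrib inner_add_right inner_vector_matrix_mult
        flip: matrix_vector_mul_assoc)
  have G_pos: "0 < w \<bullet> (G *v w)" if "w \<noteq> 0" for w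
    unfolding G_def using R P_psd that by (rule riccati_weight_pos)
  have "\<forall>w. G *v w = 0 \<longrightarrow> w = 0" using G_pos by (metis inner_zero_right less_irrefl)
  then have "invertible G"
    using invertible_left_inverse matrix_left_invertible_ker by blast
  then have "G ** matrix_inv G = mat 1"
    unfolding invertible_def matrix_inv_def by (metis (mono_tags, lifting) someI_ex)
  then have G_inv: "G *v (matrix_inv G *v y) = y" for y
    by (metis matrix_vector_mul_assoc matrix_vector_mul_lid)
  have K_vec: "K *v y = matrix_inv G *v (- (transpose B *v (P *v (A *v y))))" for y
    by (simp add: K minus_matrix_vector_mult matrix_vector_mult_minus matrix_vector_mul_assoc
        matrix_mul_assoc)
  have GK: "w \<bullet> (G *v (K *v y)) = - ((B *v w) \<bullet> (P *v (A *v y)))" for w y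
    by (simp add: K_vec G_inv inner_vector_matrix_mult)
  have "x \<bullet> (P *v x) = x \<bullet> ((transpose A ** P ** A + Q
      - transpose A ** P ** B ** matrix_inv G ** transpose B ** P ** A) *v x)"
    using P by simp
  also have "\<dots> = (A *v x) \<bullet> (P *v (A *v x)) + x \<bullet> (Q *v x) + (A *v x) \<bullet> (P *v (B *v (K *v x)))"
    by (simp add: matrix_vector_mult_add_rdistrib matrix_vector_mult_diff_rdistrib inner_add_right
        inner_diff_right inner_vector_matrix_mult K_vec matrix_vector_mult_minus
        flip: matrix_vector_mul_assoc)
  finally have "x \<bullet> (P *v x)
      = (A *v x) \<bullet> (P *v (A *v x)) + x \<bullet> (Q *v x) + (A *v x) \<bullet> (P *v (B *v (K *v x)))" .
  moreover have "(K *v x) \<bullet> (G *v u) = u \<bullet> (G *v (K *v x))"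
    unfolding G using sym[of "B *v u"] symR[of u] by simp
  ultimately show "x \<bullet> (Q *v x) + u \<bullet> (R *v u) + (A *v x + B *v u) \<bullet> (P *v (A *v x + B *v u))
      = x \<bullet> (P *v x) + (u - K *v x) \<bullet> (G *v (u - K *v x))"
    using GK[of u x] GK[of "K *v x" x] G[of u u]
      sym[of "A *v x" "B *v u"] sym[of "A *v x" "B *v (K *v x)"]
    unfolding matrix_vector_right_distrib matrix_vector_mult_diff_distrib
      inner_add_left inner_add_right inner_diff_left inner_diff_right
    by linarith
qed

section \<open>Strict Lyapunov inequalities\<close>

text \<open>
  By compactness, the strict decrease of the form \<open>y \<bullet> V y\<close> along \<open>F\<close> is at least a fixed
  fraction of the form itself, so the form contracts geometrically along the iterates.  It is
  equivalent to the squared norm, which transfers the decay to the norm.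
\<close>

lemma strict_lyapunov_decay:
  fixes V F :: "real^'n^'n"
  assumes V: "\<And>y. y \<noteq> 0 \<Longrightarrow> 0 < y \<bullet> (V *v y)"
    and less: "\<And>y. y \<noteq> 0 \<Longrightarrow> (F *v y) \<bullet> (V *v (F *v y)) < y \<bullet> (V *v y)"
  obtains C \<rho> where "0 \<le> \<rho>" "\<rho> < 1" "\<And>k y. norm ((((*v) F) ^^ k) y) \<le> C * \<rho> ^ k * norm y"
proof -
  define n where "n y = y \<bullet> (V *v y)" for y
  let ?D = "V - transpose F ** V ** F"
  have D: "y \<bullet> (?D *v y) = n y - n (F *v y)" for y
    by (simp add: n_def matrix_vector_mult_diff_rdistrib inner_diff_right inner_vector_matrix_mult
        flip: matrix_vector_mul_assoc)
  obtain a where a: "0 < a" "\<And>y. a * (norm y)\<^sup>2 \<le> n y"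
    using quadratic_form_coercive[OF V] unfolding n_def by blast
  obtain b where b: "0 < b" "\<And>y. n y \<le> b * (norm y)\<^sup>2"
    using quadratic_form_bounded[of V] unfolding n_def by blast
  have D_pos: "0 < y \<bullet> (?D *v y)" if "y \<noteq> 0" for y
    unfolding D using less[OF that] by (simp add: n_def)
  obtain e where e: "0 < e" "\<And>y. e * (norm y)\<^sup>2 \<le> n y - n (F *v y)"
    using quadratic_form_coercive[OF D_pos] unfolding D by blast
  \<comment> \<open>The decrease is at least \<open>e / b\<close> times the form; the larger denominator \<open>b + e\<close> keeps the
    factor \<open>\<theta>\<close> nonnegative, so that its square root exists.\<close>
  define \<theta> where "\<theta> = 1 - e / (b + e)"
  have \<theta>: "0 \<le> \<theta>" "\<theta> < 1" using b(1) e(1) by (auto simp: \<theta>_def field_simps)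
  have step: "n (F *v y) \<le> \<theta> * n y" for y
  proof -
    have "e * n y \<le> e * (b * (norm y)\<^sup>2)"
      using b(2) e(1) by (intro mult_left_mono) auto
    also have "\<dots> \<le> b * (n y - n (F *v y))"
      using e(2)[of y] b(1) by (simp add: mult.left_commute)
    finally have "e * n y \<le> b * (n y - n (F *v y))" .
    moreover have "0 \<le> e * (n y - n (F *v y))"
      using e(2)[of y] e(1) by (smt (verit) mult_nonneg_nonneg zero_le_power2)
    ultimately have "e * n y \<le> (b + e) * (n y - n (F *v y))" by (simp add: algebra_simps)
    then show ?thesis using b(1) e(1) by (simp add: \<theta>_def field_simps)
  qed
  have iter: "n (((*v) F ^^ k) y) \<le> \<theta> ^ k * n y" for k y
  proof (induction k)
    case (Suc k)
    have "n (((*v) F ^^ Suc k) y) \<le> \<theta> * n (((*v) F ^^ k) y)" by (simp add: step)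
    also have "\<dots> \<le> \<theta> * (\<theta> ^ k * n y)" using Suc \<theta> by (intro mult_left_mono) auto
    finally show ?case by (simp add: mult.assoc)
  qed simp
  show ?thesis
  proof
    show "0 \<le> sqrt \<theta>" "sqrt \<theta> < 1" using \<theta> by (auto simp: real_less_lsqrt)
    fix k y
    let ?z = "((*v) F ^^ k) y"
    have "a * (norm ?z)\<^sup>2 \<le> \<theta> ^ k * n y" using a(2)[of ?z] iter[of k y] by linarith
    also have "\<dots> \<le> \<theta> ^ k * (b * (norm y)\<^sup>2)" using b(2) \<theta> by (intro mult_left_mono) auto
    finally have "(norm ?z)\<^sup>2 \<le> (b / a) * \<theta> ^ k * (norm y)\<^sup>2"
      using a(1) by (simp add: field_simps)
    then have "norm ?z \<le> sqrt ((b / a) * \<theta> ^ k * (norm y)\<^sup>2)" by (rule real_le_rsqrt)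
    also have "\<dots> = sqrt (b / a) * sqrt (\<theta> ^ k) * sqrt ((norm y)\<^sup>2)"
      by (simp only: real_sqrt_mult)
    also have "\<dots> = sqrt (b / a) * sqrt \<theta> ^ k * norm y"
      by (simp add: real_sqrt_power)
    finally show "norm ?z \<le> sqrt (b / a) * sqrt \<theta> ^ k * norm y" .
  qed
qed

section \<open>Uniqueness of invariant laws of stable linear recursions\<close>

text \<open>
  The indicator of a closed set \<open>C\<close> is the pointwise limit of the Lipschitz functions
  \<open>max 0 (1 - k d(x, C))\<close>, and closed sets form a generator that is stable under intersection.
\<close>

lemma borel_prob_eq_if_lipschitz_integrals_eq:
  fixes \<mu> \<nu> :: "'a::metric_space measure"
  assumes \<mu>: "prob_space \<mu>" "sets \<mu> = sets borel" and \<nu>: "prob_space \<nu>" "sets \<nu> = sets borel"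
    and eq: "\<And>(f :: 'a \<Rightarrow> real) L. (\<And>x. \<bar>f x\<bar> \<le> 1) \<Longrightarrow> (\<And>x y. \<bar>f x - f y\<bar> \<le> L * dist x y)
      \<Longrightarrow> 0 \<le> L \<Longrightarrow> integral\<^sup>L \<mu> f = integral\<^sup>L \<nu> f"
  shows "\<mu> = \<nu>"
proof -
  have closed_eq: "measure \<mu> C = measure \<nu> C" if C: "closed C" for C
  proof (cases "C = {}")
    case False
    define f :: "nat \<Rightarrow> 'a \<Rightarrow> real" where "f k x = max 0 (1 - real k * infdist x C)" for k x
    have bd: "\<bar>f k x\<bar> \<le> 1" for k x
      by (auto simp: f_def infdist_nonneg)
    have lip: "\<bar>f k x - f k y\<bar> \<le> real k * dist x y" for k x y
    proof -
      have "\<bar>f k x - f k y\<bar> \<le> \<bar>real k * infdist x C - real k * infdist y C\<bar>"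
        unfolding f_def by linarith
      also have "\<dots> = real k * \<bar>infdist x C - infdist y C\<bar>"
        by (simp add: abs_mult flip: right_diff_distrib)
      also have "\<dots> \<le> real k * dist x y"
        by (intro mult_left_mono infdist_triangle_abs) auto
      finally show ?thesis .
    qed
    have lim: "(\<lambda>k. f k x) \<longlonglongrightarrow> indicator C x" for x
    proof (cases "x \<in> C")
      case True
      then show ?thesis by (simp add: f_def)
    next
      case False
      then have pos: "0 < infdist x C"
        using C \<open>C \<noteq> {}\<close> by (simp add: infdist_pos_not_in_closed)
      obtain n :: nat where n: "1 < real n * infdist x C"
        using pos reals_Archimedean3 by blast
      have "f k x = 0" if "k \<ge> n" for k
      proof -
        have "real n * infdist x C \<le> real k * infdist x C"
          using that pos by (intro mult_right_mono) auto
        then show ?thesis using n by (simp add: f_def)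
      qed
      then have "eventually (\<lambda>k. f k x = 0) sequentially"
        by (auto simp: eventually_sequentially)
      then show ?thesis using False by (simp add: tendsto_eventually)
    qed
    have f_meas: "f k \<in> borel_measurable borel" for k
      unfolding f_def by (intro borel_measurable_continuous_onI continuous_intros)
    have conv: "(\<lambda>k. integral\<^sup>L \<rho> (f k)) \<longlonglongrightarrow> measure \<rho> C"
      if \<rho>: "prob_space \<rho>" "sets \<rho> = sets borel" for \<rho> :: "'a measure"
    proof -
      interpret prob_space \<rho> by fact
      have [measurable]: "C \<in> sets \<rho>" "f k \<in> borel_measurable \<rho>" for k
        using C \<rho>(2) f_meas by (auto simp: measurable_cong_sets[OF \<rho>(2) refl])
      have "(\<lambda>k. integral\<^sup>L \<rho> (f k)) \<longlonglongrightarrow> integral\<^sup>L \<rho> (indicator C)"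
        by (rule integral_dominated_convergence[where w="\<lambda>_. 1"]) (auto simp: lim bd)
      then show ?thesis
        using \<rho>(2) by (simp add: sets_eq_imp_space_eq)
    qed
    have "integral\<^sup>L \<mu> (f k) = integral\<^sup>L \<nu> (f k)" for k
      using bd lip by (intro eq[where L="real k"]) auto
    then show ?thesis
      using conv[OF \<mu>] conv[OF \<nu>] LIMSEQ_unique by fastforce
  qed simp
  interpret \<mu>: prob_space \<mu> by fact
  interpret \<nu>: prob_space \<nu> by fact
  show ?thesis
  proof (rule measure_eqI_generator_eq[where E="{C. closed C}" and \<Omega>=UNIV and A="\<lambda>_. UNIV"])
    show "Int_stable {C::'a set. closed C}" by (auto simp: Int_stable_def)
    show "sets \<mu> = sigma_sets UNIV {C. closed C}" "sets \<nu> = sigma_sets UNIV {C. closed C}"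
      by (simp_all add: \<mu> \<nu> borel_eq_closed)
    show "emeasure \<mu> X = emeasure \<nu> X" if "X \<in> {C. closed C}" for X
      using closed_eq that by (simp add: \<mu>.emeasure_eq_measure \<nu>.emeasure_eq_measure)
  qed auto
qed

text \<open>
  The transition operator \<open>T g x = \<integral> g (F x + n) d\<eta>\<close> preserves the integral against an invariant
  law.  Since the two arguments of \<open>g\<close> see the same noise, the noise cancels in differences, and
  \<open>\<bar>T\<^sup>k f x - T\<^sup>k f y\<bar> \<le> L \<parallel>F\<^sup>k (x - y)\<parallel>\<close>.  So the integral of \<open>f\<close> against an invariant law
  with finite first moment differs from \<open>T\<^sup>k f 0\<close>, a number that does not involve the law, by a
  term that tends to zero.
\<close>

lemma invariant_law_unique:
  fixes F :: "'a::euclidean_space \<Rightarrow> 'a" and \<eta> \<nu>1 \<nu>2 :: "'a measure"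
  assumes F: "linear F"
    and decay: "\<And>k y. norm ((F ^^ k) y) \<le> C * \<rho> ^ k * norm y" and \<rho>: "0 \<le> \<rho>" "\<rho> < 1"
    and \<eta>: "prob_space \<eta>" "sets \<eta> = sets borel"
    and \<nu>1: "prob_space \<nu>1" "sets \<nu>1 = sets borel" "integrable \<nu>1 norm"
      "\<nu>1 = distr (\<nu>1 \<Otimes>\<^sub>M \<eta>) borel (\<lambda>(x, n). F x + n)"
    and \<nu>2: "prob_space \<nu>2" "sets \<nu>2 = sets borel" "integrable \<nu>2 norm"
      "\<nu>2 = distr (\<nu>2 \<Otimes>\<^sub>M \<eta>) borel (\<lambda>(x, n). F x + n)"
  shows "\<nu>1 = \<nu>2"
proof (rule borel_prob_eq_if_lipschitz_integrals_eq[OF \<nu>1(1,2) \<nu>2(1,2)])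
  fix f :: "'a \<Rightarrow> real" and L
  assume f_bd: "\<And>x. \<bar>f x\<bar> \<le> 1" and f_lip: "\<And>x y. \<bar>f x - f y\<bar> \<le> L * dist x y" and L: "0 \<le> L"
  interpret \<eta>: prob_space \<eta> by fact
  have F_meas [measurable]: "F \<in> borel_measurable borel"
    using F by (intro borel_measurable_continuous_onI linear_continuous_on) (rule linear_conv_bounded_linear[THEN iffD1])
  define Q :: "nat \<Rightarrow> ('a \<Rightarrow> real) \<Rightarrow> bool" where
    "Q k g \<longleftrightarrow> g \<in> borel_measurable borel \<and> (\<forall>x. \<bar>g x\<bar> \<le> 1)
       \<and> (\<forall>x y. \<bar>g x - g y\<bar> \<le> L * norm ((F ^^ k) (x - y)))" for k g
  define T :: "('a \<Rightarrow> real) \<Rightarrow> 'a \<Rightarrow> real" where "T g x = (\<integral>n. g (F x + n) \<partial>\<eta>)" for g x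
  have int_\<eta>: "integrable \<eta> (\<lambda>n. g (a + n))" if "Q k g" for g k a
  proof (rule \<eta>.integrable_const_bound[where B=1])
    have [measurable]: "g \<in> borel_measurable borel" using that by (simp add: Q_def)
    have [measurable_cong]: "sets \<eta> = sets borel" by (fact \<eta>(2))
    show "(\<lambda>n. g (a + n)) \<in> borel_measurable \<eta>" by measurable
  qed (use that in \<open>auto simp: Q_def\<close>)
  have Q_T: "Q (Suc k) (T g)" if g: "Q k g" for k g
    unfolding Q_def
  proof (intro conjI allI)
    have [measurable]: "g \<in> borel_measurable borel" using g by (simp add: Q_def)
    have [measurable_cong]: "sets \<eta> = sets borel" by (fact \<eta>(2))
    show "T g \<in> borel_measurable borel"
      unfolding T_def by measurable
    show "\<bar>T g x\<bar> \<le> 1" for x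
    proof -
      have "\<bar>T g x\<bar> \<le> (\<integral>n. \<bar>g (F x + n)\<bar> \<partial>\<eta>)"
        unfolding T_def by (rule integral_abs_bound)
      also have "\<dots> \<le> (\<integral>n. 1 \<partial>\<eta>)"
        using g by (intro integral_mono integrable_abs int_\<eta>[OF g]) (auto simp: Q_def)
      finally show ?thesis by (simp add: \<eta>.prob_space)
    qed
    show "\<bar>T g x - T g y\<bar> \<le> L * norm ((F ^^ Suc k) (x - y))" for x y
    proof -
      have "\<bar>T g x - T g y\<bar> = \<bar>\<integral>n. g (F x + n) - g (F y + n) \<partial>\<eta>\<bar>"
        unfolding T_def by (subst Bochner_Integration.integral_diff) (auto intro: int_\<eta>[OF g])
      also have "\<dots> \<le> (\<integral>n. \<bar>g (F x + n) - g (F y + n)\<bar> \<partial>\<eta>)"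
        by (rule integral_abs_bound)
      also have "\<dots> \<le> (\<integral>n. L * norm ((F ^^ Suc k) (x - y)) \<partial>\<eta>)"
      proof (intro integral_mono integrable_abs Bochner_Integration.integrable_diff int_\<eta>[OF g])
        fix n
        have "(F ^^ k) ((F x + n) - (F y + n)) = (F ^^ Suc k) (x - y)"
          using linear_diff[OF F] by (simp add: funpow_swap1)
        then show "\<bar>g (F x + n) - g (F y + n)\<bar> \<le> L * norm ((F ^^ Suc k) (x - y))"
          using g unfolding Q_def by metis
      qed simp
      finally show ?thesis by (simp add: \<eta>.prob_space)
    qed
  qed
  have Q0: "Q 0 f"
    unfolding Q_def
  proof (intro conjI allI)
    have "L-lipschitz_on UNIV f"
      using f_lip L by (intro lipschitz_onI) (auto simp: dist_real_def)
    then show "f \<in> borel_measurable borel"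
      by (intro borel_measurable_continuous_onI lipschitz_on_continuous_on)
  qed (use f_bd f_lip in \<open>auto simp: dist_norm\<close>)
  have Q_iter: "Q k ((T ^^ k) f)" for k
    by (induction k) (auto intro: Q0 Q_T)
  have bound: "\<exists>D. \<forall>k. \<bar>integral\<^sup>L \<nu> f - (T ^^ k) f 0\<bar> \<le> D * \<rho> ^ k"
    if \<nu>: "prob_space \<nu>" "sets \<nu> = sets borel" "integrable \<nu> norm"
      "\<nu> = distr (\<nu> \<Otimes>\<^sub>M \<eta>) borel (\<lambda>(x, n). F x + n)" for \<nu> :: "'a measure"
  proof -
    interpret \<nu>: prob_space \<nu> by fact
    interpret pair_prob_space \<nu> \<eta> ..
    have [measurable_cong]: "sets \<eta> = sets borel" "sets \<nu> = sets borel" by fact+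
    have int_\<nu>: "integrable \<nu> g" if "Q k g" for g k
    proof (rule \<nu>.integrable_const_bound[where B=1])
      show "g \<in> borel_measurable \<nu>"
        using that unfolding Q_def measurable_cong_sets[OF \<nu>(2) refl] by simp
    qed (use that in \<open>auto simp: Q_def\<close>)
    have inv: "integral\<^sup>L \<nu> g = integral\<^sup>L \<nu> (T g)" if g: "Q k g" for g k
    proof -
      have [measurable]: "g \<in> borel_measurable borel" using g by (simp add: Q_def)
      have "integral\<^sup>L \<nu> g = (\<integral>p. g (case p of (x, n) \<Rightarrow> F x + n) \<partial>(\<nu> \<Otimes>\<^sub>M \<eta>))"
        by (subst \<nu>(4), rule integral_distr) measurable
      also have "\<dots> = (\<integral>p. (case p of (x, n) \<Rightarrow> g (F x + n)) \<partial>(\<nu> \<Otimes>\<^sub>M \<eta>))"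
        by (intro Bochner_Integration.integral_cong) auto
      also have "\<dots> = (\<integral>x. (\<integral>n. g (F x + n) \<partial>\<eta>) \<partial>\<nu>)"
      proof (rule integral_fst'[symmetric, of "\<lambda>(x, n). g (F x + n)", simplified])
        show "integrable (\<nu> \<Otimes>\<^sub>M \<eta>) (\<lambda>(x, n). g (F x + n))"
          using g by (intro integrable_const_bound[where B=1]) (auto simp: Q_def)
      qed
      finally show ?thesis by (simp add: T_def[abs_def])
    qed
    have iter: "integral\<^sup>L \<nu> f = integral\<^sup>L \<nu> ((T ^^ k) f)" for k
      by (induction k) (auto simp: inv[OF Q_iter])
    have "\<bar>integral\<^sup>L \<nu> f - (T ^^ k) f 0\<bar> \<le> (L * C * (\<integral>x. norm x \<partial>\<nu>)) * \<rho> ^ k" for k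
    proof -
      let ?g = "(T ^^ k) f"
      have "\<bar>integral\<^sup>L \<nu> f - ?g 0\<bar> = \<bar>\<integral>x. ?g x - ?g 0 \<partial>\<nu>\<bar>"
        using int_\<nu>[OF Q_iter] by (simp add: iter[of k] \<nu>.prob_space)
      also have "\<dots> \<le> (\<integral>x. \<bar>?g x - ?g 0\<bar> \<partial>\<nu>)"
        by (rule integral_abs_bound)
      also have "\<dots> \<le> (\<integral>x. (L * C * \<rho> ^ k) * norm x \<partial>\<nu>)"
      proof (intro integral_mono integrable_abs Bochner_Integration.integrable_diff int_\<nu>[OF Q_iter])
        fix x
        have "\<bar>?g x - ?g 0\<bar> \<le> L * norm ((F ^^ k) (x - 0))"
          using Q_iter[of k] unfolding Q_def by blast
        also have "\<dots> \<le> L * (C * \<rho> ^ k * norm x)"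
          using decay L by (intro mult_left_mono) auto
        finally show "\<bar>?g x - ?g 0\<bar> \<le> (L * C * \<rho> ^ k) * norm x"
          by (simp add: mult.assoc)
      qed (use \<nu>(3) in auto)
      finally show ?thesis by (simp add: mult_ac)
    qed
    then show ?thesis by blast
  qed
  obtain D1 D2 where D: "\<And>k. \<bar>integral\<^sup>L \<nu>1 f - (T ^^ k) f 0\<bar> \<le> D1 * \<rho> ^ k"
    "\<And>k. \<bar>integral\<^sup>L \<nu>2 f - (T ^^ k) f 0\<bar> \<le> D2 * \<rho> ^ k"
    using bound[OF \<nu>1] bound[OF \<nu>2] by blast
  have "\<bar>integral\<^sup>L \<nu>1 f - integral\<^sup>L \<nu>2 f\<bar> \<le> (D1 + D2) * \<rho> ^ k" for k
    using D[of k] unfolding distrib_right by linarith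
  moreover have "(\<lambda>k. (D1 + D2) * \<rho> ^ k) \<longlonglongrightarrow> (D1 + D2) * 0"
    using \<rho> by (intro tendsto_mult_left LIMSEQ_realpow_zero) auto
  ultimately have "\<bar>integral\<^sup>L \<nu>1 f - integral\<^sup>L \<nu>2 f\<bar> \<le> 0"
    by (metis (no_types, lifting) LIMSEQ_le_const mult_zero_right)
  then show "integral\<^sup>L \<nu>1 f = integral\<^sup>L \<nu>2 f" by simp
qed

section \<open>Square-integrable random vectors\<close>

lemma borel_measurable_matrix_vector_mult [measurable]:
  "(*v) F \<in> borel_measurable borel" for F :: "real^'n^'m"
  by (intro borel_measurable_continuous_onI linear_continuous_on matrix_vector_mul_bounded_linear)

lemma L2D:
  assumes "X \<in> L2 M G"
  shows "X \<in> borel_measurable G" "X \<in> borel_measurable M"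
    "integrable M (\<lambda>\<omega>. (norm (X \<omega>))\<^sup>2)" "subalgebra M G" "X \<in> L2 M M"
proof -
  show *: "X \<in> borel_measurable G" "integrable M (\<lambda>\<omega>. (norm (X \<omega>))\<^sup>2)" "subalgebra M G"
    using assms by (auto simp: L2_def)
  then show "X \<in> borel_measurable M" by (auto intro: measurable_from_subalg)
  with * show "X \<in> L2 M M" by (auto simp: L2_def subalgebra_def)
qed

lemma (in prob_space) L2_const: "subalgebra M G \<Longrightarrow> (\<lambda>_. a) \<in> L2 M G"
  by (simp add: L2_def)

lemma (in prob_space) L2_const_self [simp]: "(\<lambda>_. a) \<in> L2 M M"
  by (rule L2_const) (simp add: subalgebra_def)

lemma L2_add:
  assumes "X \<in> L2 M G" "Y \<in> L2 M G"
  shows "(\<lambda>\<omega>. X \<omega> + Y \<omega>) \<in> L2 M G"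
proof -
  note X = L2D[OF assms(1)] and Y = L2D[OF assms(2)]
  have [measurable]: "X \<in> borel_measurable M" "Y \<in> borel_measurable M" by fact+
  have "integrable M (\<lambda>\<omega>. (norm (X \<omega> + Y \<omega>))\<^sup>2)"
  proof (rule Bochner_Integration.integrable_bound)
    show "integrable M (\<lambda>\<omega>. 2 * (norm (X \<omega>))\<^sup>2 + 2 * (norm (Y \<omega>))\<^sup>2)"
      using X Y by auto
    have "(norm (x + y))\<^sup>2 \<le> 2 * (norm x)\<^sup>2 + 2 * (norm y)\<^sup>2" for x y :: 'b
      using zero_le_power2[of "norm (x - y)"]
      by (simp add: power2_norm_eq_inner inner_diff inner_add inner_commute)
    then show "AE \<omega> in M. norm ((norm (X \<omega> + Y \<omega>))\<^sup>2)
        \<le> norm (2 * (norm (X \<omega>))\<^sup>2 + 2 * (norm (Y \<omega>))\<^sup>2)"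
      by auto
  qed measurable
  then show ?thesis using X Y by (auto simp: L2_def)
qed

lemma L2_minus: "X \<in> L2 M G \<Longrightarrow> (\<lambda>\<omega>. - X \<omega>) \<in> L2 M G"
  by (simp add: L2_def)

lemma L2_diff: "X \<in> L2 M G \<Longrightarrow> Y \<in> L2 M G \<Longrightarrow> (\<lambda>\<omega>. X \<omega> - Y \<omega>) \<in> L2 M G"
  using L2_add[OF _ L2_minus, of X M G Y] by simp

lemma L2_matrix_vector_mult:
  fixes F :: "real^'n^'m"
  assumes "X \<in> L2 M G"
  shows "(\<lambda>\<omega>. F *v X \<omega>) \<in> L2 M G"
proof -
  note X = L2D[OF assms]
  have [measurable]: "X \<in> borel_measurable M" "X \<in> borel_measurable G" by fact+
  have "integrable M (\<lambda>\<omega>. (norm (F *v X \<omega>))\<^sup>2)"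
  proof (rule Bochner_Integration.integrable_bound)
    show "integrable M (\<lambda>\<omega>. (onorm ((*v) F))\<^sup>2 * (norm (X \<omega>))\<^sup>2)"
      using X by auto
    have "(norm (F *v x))\<^sup>2 \<le> (onorm ((*v) F))\<^sup>2 * (norm x)\<^sup>2" for x
      using power_mono[OF onorm[OF matrix_vector_mul_bounded_linear[of F], of x], of 2]
      by (simp add: power_mult_distrib)
    then show "AE \<omega> in M. norm ((norm (F *v X \<omega>))\<^sup>2)
        \<le> norm ((onorm ((*v) F))\<^sup>2 * (norm (X \<omega>))\<^sup>2)"
      by auto
  qed measurable
  then show ?thesis using X by (auto simp: L2_def)
qed

lemmas (in prob_space) L2_intros = L2_const_self L2_add L2_diff L2_matrix_vector_mult

lemma (in prob_space) L2_integrable: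
  assumes "X \<in> L2 M G"
  shows "integrable M X"
proof -
  note X = L2D[OF assms]
  have "integrable M (\<lambda>\<omega>. norm (X \<omega>))"
    using X(2,3) by (intro square_integrable_imp_integrable[of "\<lambda>\<omega>. norm (X \<omega>)"]) measurable
  then show ?thesis using X(2) by (simp add: integrable_norm_iff)
qed

lemma L2_integrable_inner:
  assumes "X \<in> L2 M G" "Y \<in> L2 M G"
  shows "integrable M (\<lambda>\<omega>. X \<omega> \<bullet> Y \<omega>)"
proof (rule Bochner_Integration.integrable_bound)
  note X = L2D[OF assms(1)] and Y = L2D[OF assms(2)]
  have [measurable]: "X \<in> borel_measurable M" "Y \<in> borel_measurable M" by fact+
  show "integrable M (\<lambda>\<omega>. (norm (X \<omega>))\<^sup>2 + (norm (Y \<omega>))\<^sup>2)" using X Y by auto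
  have "\<bar>x \<bullet> y\<bar> \<le> (norm x)\<^sup>2 + (norm y)\<^sup>2" for x y :: 'b
  proof -
    have "0 \<le> norm x * norm y" by simp
    then show ?thesis
      using Cauchy_Schwarz_ineq2[of x y] sum_squares_bound[of "norm x" "norm y"] by linarith
  qed
  then show "AE \<omega> in M. norm (X \<omega> \<bullet> Y \<omega>) \<le> norm ((norm (X \<omega>))\<^sup>2 + (norm (Y \<omega>))\<^sup>2)"
    by auto
  show "(\<lambda>\<omega>. X \<omega> \<bullet> Y \<omega>) \<in> borel_measurable M" by measurable
qed

lemma L2_integrable_quadratic:
  fixes Q :: "real^'n^'n"
  assumes "X \<in> L2 M G"
  shows "integrable M (\<lambda>\<omega>. X \<omega> \<bullet> (Q *v X \<omega>))"
  using assms by (intro L2_integrable_inner L2_matrix_vector_mult)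

lemma (in prob_space) expectation_matrix_vector_mult:
  "integrable M X \<Longrightarrow> expectation (\<lambda>\<omega>. F *v X \<omega>) = F *v expectation X"
  for F :: "real^'n^'m"
  by (rule integral_bounded_linear[OF matrix_vector_mul_bounded_linear])

lemma (in prob_space) expectation_quadratic_centered:
  fixes Q :: "real^'n^'n"
  assumes X: "X \<in> L2 M M"
  defines "m \<equiv> expectation X"
  shows "expectation (\<lambda>\<omega>. X \<omega> \<bullet> (Q *v X \<omega>))
    = expectation (\<lambda>\<omega>. (X \<omega> - m) \<bullet> (Q *v (X \<omega> - m))) + m \<bullet> (Q *v m)"
proof -
  have int: "integrable M X" "integrable M (\<lambda>\<omega>. X \<omega> \<bullet> (Q *v X \<omega>))"
    using X by (auto intro: L2_integrable L2_integrable_quadratic)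
  have int_QX: "integrable M (\<lambda>\<omega>. Q *v X \<omega>)"
    using X by (auto intro: L2_integrable L2_matrix_vector_mult)
  have "expectation (\<lambda>\<omega>. (X \<omega> - m) \<bullet> (Q *v (X \<omega> - m)))
    = expectation (\<lambda>\<omega>. X \<omega> \<bullet> (Q *v X \<omega>) - X \<omega> \<bullet> (Q *v m) - m \<bullet> (Q *v X \<omega>) + m \<bullet> (Q *v m))"
    by (intro Bochner_Integration.integral_cong refl)
      (simp add: matrix_vector_mult_diff_distrib inner_diff algebra_simps)
  also have "\<dots> = expectation (\<lambda>\<omega>. X \<omega> \<bullet> (Q *v X \<omega>)) - m \<bullet> (Q *v m)"
    using int int_QX by (simp add: prob_space m_def expectation_matrix_vector_mult)
  finally show ?thesis by simp
qed

text \<open>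
  Together with the decomposition of \<open>\<E>[X \<bullet> Q1 X]\<close> above, this merges \<open>Q2\<close> with \<open>Q1\<close> in the
  weight of the fluctuation.
\<close>

lemma (in prob_space) trace_cov_matrix:
  fixes Q :: "real^'n^'n"
  assumes X: "X \<in> L2 M M"
  shows "trace (Q ** cov_matrix M X)
    = expectation (\<lambda>\<omega>. (X \<omega> - expectation X) \<bullet> (Q *v (X \<omega> - expectation X)))"
proof -
  define Y where "Y \<omega> = X \<omega> - expectation X" for \<omega>
  have Y: "Y \<in> L2 M M"
    unfolding Y_def using X by (intro L2_intros)
  have comp: "(\<integral>\<omega>. X \<omega> $ i \<partial>M) = expectation X $ i" for i
    using L2_integrable[OF X] by (rule integral_bounded_linear[OF bounded_linear_vec_nth])
  have int: "integrable M (\<lambda>\<omega>. Y \<omega> $ i * Y \<omega> $ k)" for i k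
  proof (rule Bochner_Integration.integrable_bound)
    note L2D[OF Y]
    then have [measurable]: "Y \<in> borel_measurable M" by simp
    have [measurable]: "(\<lambda>y::real^'n. y $ k) \<in> borel_measurable borel" for k
      by (intro borel_measurable_continuous_onI continuous_intros)
    show "integrable M (\<lambda>\<omega>. (norm (Y \<omega>))\<^sup>2)" by fact
    show "(\<lambda>\<omega>. Y \<omega> $ i * Y \<omega> $ k) \<in> borel_measurable M" by measurable
    have "\<bar>y $ i * y $ k\<bar> \<le> (norm y)\<^sup>2" for y :: "real^'n"
      unfolding abs_mult power2_eq_square by (intro mult_mono component_le_norm_cart) auto
    then show "AE \<omega> in M. norm (Y \<omega> $ i * Y \<omega> $ k) \<le> norm ((norm (Y \<omega>))\<^sup>2)" by auto
  qed
  have "trace (Q ** cov_matrix M X) = (\<Sum>i\<in>UNIV. \<Sum>k\<in>UNIV. Q $ i $ k * (\<integral>\<omega>. Y \<omega> $ k * Y \<omega> $ i \<partial>M))"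
    by (simp add: trace_def matrix_matrix_mult_def cov_matrix_def comp Y_def)
  also have "\<dots> = (\<integral>\<omega>. (\<Sum>i\<in>UNIV. \<Sum>k\<in>UNIV. Q $ i $ k * (Y \<omega> $ k * Y \<omega> $ i)) \<partial>M)"
    using int by simp
  also have "\<dots> = (\<integral>\<omega>. Y \<omega> \<bullet> (Q *v Y \<omega>) \<partial>M)"
    by (intro Bochner_Integration.integral_cong refl)
      (simp add: inner_vec_def matrix_vector_mult_def sum_distrib_left mult_ac)
  finally show ?thesis by (simp add: Y_def)
qed

section \<open>Independence\<close>

lemma sets_vimage_algebra_compose_subset:
  assumes "f \<in> measurable N L" "X \<in> S \<rightarrow> space N"
  shows "sets (vimage_algebra S (\<lambda>\<omega>. f (X \<omega>)) L) \<subseteq> sets (vimage_algebra S X N)"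
proof -
  have "(\<lambda>\<omega>. f (X \<omega>)) \<in> measurable (vimage_algebra S X N) L"
    by (rule measurable_compose[OF measurable_vimage_algebra1 assms(1)]) (fact assms(2))
  then have "{(\<lambda>\<omega>. f (X \<omega>)) -` A \<inter> S |A. A \<in> sets L} \<subseteq> sets (vimage_algebra S X N)"
    by (auto dest: measurable_sets)
  then show ?thesis
    unfolding sets_vimage_algebra[of S "\<lambda>\<omega>. f (X \<omega>)"]
    using sets.sigma_sets_subset[of _ "vimage_algebra S X N"] by simp
qed

lemma (in prob_space) indep_rvs_compose:
  assumes ind: "indep_rvs M X Y" and f: "f \<in> borel_measurable borel" and g: "g \<in> borel_measurable borel"
  shows "indep_rvs M (\<lambda>\<omega>. f (X \<omega>)) (\<lambda>\<omega>. g (Y \<omega>))"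
  unfolding indep_rvs_def
proof (rule indep_setI)
  note ind' = ind[unfolded indep_rvs_def]
  have sub: "sets (vimage_algebra (space M) (\<lambda>\<omega>. f (X \<omega>)) borel) \<subseteq> sets (vimage_algebra (space M) X borel)"
    "sets (vimage_algebra (space M) (\<lambda>\<omega>. g (Y \<omega>)) borel) \<subseteq> sets (vimage_algebra (space M) Y borel)"
    using f g by (simp_all add: sets_vimage_algebra_compose_subset)
  note ev = iffD1[OF indep_sets2_eq ind', THEN conjunct1]
    iffD1[OF indep_sets2_eq ind', THEN conjunct2, THEN conjunct1]
  show "sets (vimage_algebra (space M) (\<lambda>\<omega>. f (X \<omega>)) borel) \<subseteq> events"
    "sets (vimage_algebra (space M) (\<lambda>\<omega>. g (Y \<omega>)) borel) \<subseteq> events"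
    using order_trans[OF sub(1) ev(1)] order_trans[OF sub(2) ev(2)] .
  fix a b
  assume "a \<in> sets (vimage_algebra (space M) (\<lambda>\<omega>. f (X \<omega>)) borel)"
    and "b \<in> sets (vimage_algebra (space M) (\<lambda>\<omega>. g (Y \<omega>)) borel)"
  then show "prob (a \<inter> b) = prob a * prob b"
    by (intro indep_setD[OF ind'] subsetD[OF sub(1)] subsetD[OF sub(2)])
qed

lemma (in prob_space) indep_rvs_commute:
  assumes "indep_rvs M X Y"
  shows "indep_rvs M Y X"
  unfolding indep_rvs_def
proof (rule indep_setI)
  note ind = assms[unfolded indep_rvs_def]
  show "sets (vimage_algebra (space M) Y borel) \<subseteq> events"
    "sets (vimage_algebra (space M) X borel) \<subseteq> events"
    using iffD1[OF indep_sets2_eq ind, THEN conjunct2, THEN conjunct1]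
      iffD1[OF indep_sets2_eq ind, THEN conjunct1] .
  show "prob (a \<inter> b) = prob a * prob b"
    if "a \<in> sets (vimage_algebra (space M) Y borel)" "b \<in> sets (vimage_algebra (space M) X borel)" for a b
    using indep_setD[OF ind that(2,1)] by (simp add: Int_commute mult.commute)
qed

text \<open>
  The predicate \<open>indep_var\<close>, which carries the product formulas, wants a common codomain;
  this is reached by mapping state and noise into one space.
\<close>

lemma (in prob_space) indep_var_of_indep_rvs:
  assumes ind: "indep_rvs M X Y"
    and X: "X \<in> borel_measurable M" and Y: "Y \<in> borel_measurable M"
    and f: "f \<in> borel_measurable borel" and g: "g \<in> borel_measurable borel"
  shows "indep_var borel (\<lambda>\<omega>. f (X \<omega>)) borel (\<lambda>\<omega>. g (Y \<omega>))"
  using indep_rvs_compose[OF ind f g] measurable_compose[OF X f] measurable_compose[OF Y g]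
  by (simp add: indep_var_eq indep_rvs_def sets_vimage_algebra)

lemma (in prob_space) indep_var_expectation_inner:
  fixes X Y :: "'a \<Rightarrow> 'b::euclidean_space"
  assumes ind: "indep_var borel X borel Y" and int: "integrable M X" "integrable M Y"
  shows "expectation (\<lambda>\<omega>. X \<omega> \<bullet> Y \<omega>) = expectation X \<bullet> expectation Y"
proof -
  have ind_b: "indep_var borel (\<lambda>\<omega>. X \<omega> \<bullet> b) borel (\<lambda>\<omega>. Y \<omega> \<bullet> b)" for b
    using indep_var_compose[OF ind, of "\<lambda>x. x \<bullet> b" borel "\<lambda>x. x \<bullet> b" borel] by (simp add: comp_def)
  have "expectation (\<lambda>\<omega>. X \<omega> \<bullet> Y \<omega>) = expectation (\<lambda>\<omega>. \<Sum>b\<in>Basis. (X \<omega> \<bullet> b) * (Y \<omega> \<bullet> b))"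
    by (subst euclidean_inner) simp
  also have "\<dots> = (\<Sum>b\<in>Basis. expectation (\<lambda>\<omega>. (X \<omega> \<bullet> b) * (Y \<omega> \<bullet> b)))"
    using int by (intro Bochner_Integration.integral_sum indep_var_integrable[OF ind_b]) auto
  also have "\<dots> = (\<Sum>b\<in>Basis. expectation (\<lambda>\<omega>. X \<omega> \<bullet> b) * expectation (\<lambda>\<omega>. Y \<omega> \<bullet> b))"
    using int by (intro sum.cong refl indep_var_lebesgue_integral[OF ind_b]) auto
  also have "\<dots> = expectation X \<bullet> expectation Y"
    using int by (subst (3) euclidean_inner) simp
  finally show ?thesis .
qed

text \<open>
  The mixed terms are expectations of inner products of independent vectors, one of them centred.
\<close>

lemma (in prob_space) expectation_quadratic_add_noise:
  fixes P :: "real^'n^'n"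
  assumes ind: "indep_var borel X borel N" and X: "X \<in> L2 M M" and N: "N \<in> L2 M M"
    and N0: "expectation N = 0"
  shows "expectation (\<lambda>\<omega>. (X \<omega> + N \<omega>) \<bullet> (P *v (X \<omega> + N \<omega>)))
    = expectation (\<lambda>\<omega>. X \<omega> \<bullet> (P *v X \<omega>)) + expectation (\<lambda>\<omega>. N \<omega> \<bullet> (P *v N \<omega>))"
proof -
  have PX: "(\<lambda>\<omega>. P *v X \<omega>) \<in> L2 M M" and PN: "(\<lambda>\<omega>. P *v N \<omega>) \<in> L2 M M"
    using X N by (auto intro: L2_matrix_vector_mult)
  have "indep_var borel ((\<lambda>x. x) \<circ> X) borel ((*v) P \<circ> N)"
    by (rule indep_var_compose[OF ind]) measurable
  then have 1: "expectation (\<lambda>\<omega>. X \<omega> \<bullet> (P *v N \<omega>)) = 0"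
    using indep_var_expectation_inner[of X "\<lambda>\<omega>. P *v N \<omega>"] X N PN N0
    by (simp add: comp_def L2_integrable expectation_matrix_vector_mult)
  have "indep_var borel ((*v) P \<circ> X) borel ((\<lambda>x. x) \<circ> N)"
    by (rule indep_var_compose[OF ind]) measurable
  then have 2: "expectation (\<lambda>\<omega>. N \<omega> \<bullet> (P *v X \<omega>)) = 0"
    using indep_var_expectation_inner[of "\<lambda>\<omega>. P *v X \<omega>" N] X N PX N0
    by (simp add: comp_def L2_integrable inner_commute)
  have int: "integrable M (\<lambda>\<omega>. Y \<omega> \<bullet> (P *v Z \<omega>))" if "Y \<in> L2 M M" "Z \<in> L2 M M" for Y Z
    using that by (intro L2_integrable_inner[of _ M M] L2_matrix_vector_mult)
  show ?thesis
    using X N 1 2 by (simp add: matrix_vector_right_distrib inner_add int)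
qed

lemma (in prob_space) distr_add_indep:
  fixes F :: "'b::euclidean_space \<Rightarrow> 'b"
  assumes ind: "indep_var borel X borel N" and F [measurable]: "F \<in> borel_measurable borel"
  shows "distr M borel (\<lambda>\<omega>. F (X \<omega>) + N \<omega>)
    = distr (distr M borel X \<Otimes>\<^sub>M distr M borel N) borel (\<lambda>(x, n). F x + n)"
proof -
  have [measurable]: "X \<in> borel_measurable M" "N \<in> borel_measurable M"
    and eq: "distr M borel X \<Otimes>\<^sub>M distr M borel N = distr M (borel \<Otimes>\<^sub>M borel) (\<lambda>\<omega>. (X \<omega>, N \<omega>))"
    using ind by (auto simp: indep_var_distribution_eq)
  show ?thesis
    unfolding eq by (subst distr_distr) (auto simp: comp_def)
qed

lemma (in prob_space) stationary_law_unique: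
  fixes F :: "real^'n^'n" and X1 X2 N1 N2 :: "'a \<Rightarrow> real^'n"
  assumes decay: "\<And>k y. norm (((*v) F ^^ k) y) \<le> C * \<rho> ^ k * norm y" "0 \<le> \<rho>" "\<rho> < 1"
    and X: "X1 \<in> L2 M M" "X2 \<in> L2 M M"
    and ind: "indep_var borel X1 borel N1" "indep_var borel X2 borel N2"
    and noise: "distr M borel N1 = distr M borel N2"
    and stat: "distr M borel (\<lambda>\<omega>. F *v X1 \<omega> + N1 \<omega>) = distr M borel X1"
      "distr M borel (\<lambda>\<omega>. F *v X2 \<omega> + N2 \<omega>) = distr M borel X2"
  shows "distr M borel X1 = distr M borel X2"
proof (rule invariant_law_unique[where F="(*v) F" and \<eta>="distr M borel N1", OF _ decay])
  note [measurable] = L2D(2)[OF X(1)] L2D(2)[OF X(2)] indep_var_rv2[OF ind(1)]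
  show "prob_space (distr M borel X1)" "prob_space (distr M borel X2)" "prob_space (distr M borel N1)"
    by (simp_all add: prob_space_distr)
  show "integrable (distr M borel X1) norm" "integrable (distr M borel X2) norm"
    using X by (simp_all add: integrable_distr_eq L2_integrable)
  show "distr M borel X1 = distr (distr M borel X1 \<Otimes>\<^sub>M distr M borel N1) borel (\<lambda>(x, n). F *v x + n)"
    using distr_add_indep[OF ind(1), of "(*v) F"] stat(1) by simp
  show "distr M borel X2 = distr (distr M borel X2 \<Otimes>\<^sub>M distr M borel N1) borel (\<lambda>(x, n). F *v x + n)"
    using distr_add_indep[OF ind(2), of "(*v) F"] stat(2) noise by simp
qed simp_all

section \<open>The stage cost at stationarity\<close>

lemma (in prob_space) stage_cost_mean_fluctuation:
  fixes X :: "'a \<Rightarrow> real^'n" and U :: "'a \<Rightarrow> real^'l"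
  assumes X: "X \<in> L2 M M" and U: "U \<in> L2 M M"
  defines "x \<equiv> expectation X" and "u \<equiv> expectation U"
  shows "stage_cost M Q1 Q2 R1 R2 r v c X U
    = expectation (\<lambda>\<omega>. (X \<omega> - x) \<bullet> ((Q1 + Q2) *v (X \<omega> - x)) + (U \<omega> - u) \<bullet> ((R1 + R2) *v (U \<omega> - u)))
      + (x \<bullet> (Q1 *v x) + u \<bullet> (R1 *v u) + r \<bullet> x + v \<bullet> u + c)"
proof -
  have int [simp]: "integrable M X" "integrable M U"
    "integrable M (\<lambda>\<omega>. X \<omega> \<bullet> (Q *v X \<omega>))" "integrable M (\<lambda>\<omega>. U \<omega> \<bullet> (R *v U \<omega>))"
    "integrable M (\<lambda>\<omega>. (X \<omega> - x) \<bullet> (Q *v (X \<omega> - x)))"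
    "integrable M (\<lambda>\<omega>. (U \<omega> - u) \<bullet> (R *v (U \<omega> - u)))" for Q R
    using X U by (auto intro!: L2_integrable[of _ M] L2_integrable_quadratic[of _ M M] L2_intros)
  have "expectation (\<lambda>\<omega>. X \<omega> \<bullet> (Q1 *v X \<omega>) + U \<omega> \<bullet> (R1 *v U \<omega>) + r \<bullet> X \<omega> + v \<bullet> U \<omega> + c)
    = expectation (\<lambda>\<omega>. X \<omega> \<bullet> (Q1 *v X \<omega>)) + expectation (\<lambda>\<omega>. U \<omega> \<bullet> (R1 *v U \<omega>)) + r \<bullet> x + v \<bullet> u + c"
    by (simp add: prob_space x_def u_def)
  then show ?thesis
    unfolding stage_cost_def trace_cov_matrix[OF X] trace_cov_matrix[OF U]
    by (simp add: expectation_quadratic_centered[OF X] expectation_quadratic_centered[OF U]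
        matrix_vector_mult_add_rdistrib inner_add_right flip: x_def u_def)
qed

lemma (in prob_space) stage_cost_deterministic:
  "stage_cost M Q1 Q2 R1 R2 r v c (\<lambda>_. x) (\<lambda>_. u)
    = x \<bullet> (Q1 *v x) + u \<bullet> (R1 *v u) + r \<bullet> x + v \<bullet> u + c"
  by (subst stage_cost_mean_fluctuation) (simp_all add: prob_space)

lemma (in prob_space) storage_deterministic: "storage M S q (\<lambda>_. x) = x \<bullet> (S *v x) + q \<bullet> x"
  by (simp add: storage_def prob_space)

text \<open>
  The vector \<open>d\<close> collects the drift, so that \<open>N\<close> can be centred.  The expectation of the Riccati
  identity, applied to the fluctuations, contains the \<open>P\<close>-energy of \<open>X'\<close> and of \<open>A X' + B U'\<close>;
  as the next state has the law of \<open>X\<close>, these differ exactly by the energy of the noise.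
  Averaging the dynamics itself gives the steady-state equation of the means.
\<close>

lemma (in prob_space) stationary_cost:
  fixes A P Q1 Q2 :: "real^'n^'n" and B :: "real^'l^'n" and R1 R2 :: "real^'l^'l"
    and X N :: "'a \<Rightarrow> real^'n" and U :: "'a \<Rightarrow> real^'l"
  assumes X: "X \<in> L2 M M" and U: "U \<in> L2 M M" and N: "N \<in> L2 M M"
    and ind: "indep_var borel (\<lambda>\<omega>. A *v X \<omega> + B *v U \<omega>) borel N"
    and N0: "expectation N = 0"
    and stat: "distr M borel (\<lambda>\<omega>. A *v X \<omega> + B *v U \<omega> + N \<omega> + d) = distr M borel X"
    and square: "\<And>x u. x \<bullet> ((Q1 + Q2) *v x) + u \<bullet> ((R1 + R2) *v u)
        + (A *v x + B *v u) \<bullet> (P *v (A *v x + B *v u))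
      = x \<bullet> (P *v x) + (u - K *v x) \<bullet> (G *v (u - K *v x))"
  defines "x \<equiv> expectation X" and "u \<equiv> expectation U"
  shows "A *v x + B *v u + d = x"
    and "stage_cost M Q1 Q2 R1 R2 r v c X U
      = expectation (\<lambda>\<omega>. N \<omega> \<bullet> (P *v N \<omega>))
        + expectation (\<lambda>\<omega>. (U \<omega> - u - K *v (X \<omega> - x)) \<bullet> (G *v (U \<omega> - u - K *v (X \<omega> - x))))
        + (x \<bullet> (Q1 *v x) + u \<bullet> (R1 *v u) + r \<bullet> x + v \<bullet> u + c)"
proof -
  let ?X' = "\<lambda>\<omega>. X \<omega> - x" and ?U' = "\<lambda>\<omega>. U \<omega> - u"
  let ?Y = "\<lambda>\<omega>. A *v ?X' \<omega> + B *v ?U' \<omega>"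
  let ?next = "\<lambda>\<omega>. A *v X \<omega> + B *v U \<omega> + N \<omega> + d"
  note [simp] = L2_integrable[OF X] L2_integrable[OF U] L2_integrable[OF N]
  have next_L2: "?next \<in> L2 M M"
    using X U N by (intro L2_intros)
  note [measurable] = L2D(2)[OF X] L2D(2)[OF U] L2D(2)[OF N] L2D(2)[OF next_L2]
  have law: "expectation (\<lambda>\<omega>. h (X \<omega>)) = expectation (\<lambda>\<omega>. h (?next \<omega>))"
    if [measurable]: "h \<in> borel_measurable borel" for h :: "real^'n \<Rightarrow> 'z::{banach, second_countable_topology}"
  proof -
    have "expectation (\<lambda>\<omega>. h (X \<omega>)) = integral\<^sup>L (distr M borel X) h"
      by (simp add: integral_distr)
    also have "\<dots> = expectation (\<lambda>\<omega>. h (?next \<omega>))"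
      unfolding stat[symmetric] by (simp add: integral_distr)
    finally show ?thesis .
  qed
  have int_AX: "integrable M (\<lambda>\<omega>. A *v X \<omega>)" "integrable M (\<lambda>\<omega>. B *v U \<omega>)"
    using X U by (auto intro!: L2_integrable[of _ M] L2_intros)
  have "x = expectation ?next"
    unfolding x_def using law[of "\<lambda>y. y"] by simp
  also have "\<dots> = A *v x + B *v u + d"
    using int_AX by (simp add: N0 prob_space x_def u_def expectation_matrix_vector_mult)
  finally show mean: "A *v x + B *v u + d = x" ..
  have L2': "?X' \<in> L2 M M" "?U' \<in> L2 M M" "?Y \<in> L2 M M" "(\<lambda>\<omega>. ?U' \<omega> - K *v ?X' \<omega>) \<in> L2 M M"
    using X U by (auto intro!: L2_intros)
  have Y_eq: "?Y = (\<lambda>y. y - (A *v x + B *v u)) \<circ> (\<lambda>\<omega>. A *v X \<omega> + B *v U \<omega>)"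
    by (auto simp: matrix_vector_mult_diff_distrib)
  have "indep_var borel ?Y borel ((\<lambda>n. n) \<circ> N)"
    unfolding Y_eq by (rule indep_var_compose[OF ind]) auto
  then have ind_Y: "indep_var borel ?Y borel N" by (simp add: comp_def)
  have next_eq: "?next \<omega> - x = ?Y \<omega> + N \<omega>" for \<omega>
    using mean by (simp add: matrix_vector_mult_diff_distrib algebra_simps)
  have "expectation (\<lambda>\<omega>. ?X' \<omega> \<bullet> (P *v ?X' \<omega>)) = expectation (\<lambda>\<omega>. (?next \<omega> - x) \<bullet> (P *v (?next \<omega> - x)))"
    by (rule law) measurable
  also have "\<dots> = expectation (\<lambda>\<omega>. ?Y \<omega> \<bullet> (P *v ?Y \<omega>)) + expectation (\<lambda>\<omega>. N \<omega> \<bullet> (P *v N \<omega>))"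
    unfolding next_eq by (rule expectation_quadratic_add_noise[OF ind_Y L2'(3) N N0])
  finally have energy: "expectation (\<lambda>\<omega>. ?X' \<omega> \<bullet> (P *v ?X' \<omega>))
      = expectation (\<lambda>\<omega>. ?Y \<omega> \<bullet> (P *v ?Y \<omega>)) + expectation (\<lambda>\<omega>. N \<omega> \<bullet> (P *v N \<omega>))" .
  have "expectation (\<lambda>\<omega>. ?X' \<omega> \<bullet> ((Q1 + Q2) *v ?X' \<omega>) + ?U' \<omega> \<bullet> ((R1 + R2) *v ?U' \<omega>))
    = expectation (\<lambda>\<omega>. ?X' \<omega> \<bullet> (P *v ?X' \<omega>)
        + (?U' \<omega> - K *v ?X' \<omega>) \<bullet> (G *v (?U' \<omega> - K *v ?X' \<omega>)) - ?Y \<omega> \<bullet> (P *v ?Y \<omega>))"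
    by (intro Bochner_Integration.integral_cong refl) (simp flip: square)
  also have "\<dots> = expectation (\<lambda>\<omega>. N \<omega> \<bullet> (P *v N \<omega>))
      + expectation (\<lambda>\<omega>. (?U' \<omega> - K *v ?X' \<omega>) \<bullet> (G *v (?U' \<omega> - K *v ?X' \<omega>)))"
    using L2'[THEN L2_integrable_quadratic] by (simp add: energy)
  finally show "stage_cost M Q1 Q2 R1 R2 r v c X U
      = expectation (\<lambda>\<omega>. N \<omega> \<bullet> (P *v N \<omega>))
        + expectation (\<lambda>\<omega>. (U \<omega> - u - K *v (X \<omega> - x)) \<bullet> (G *v (U \<omega> - u - K *v (X \<omega> - x))))
        + (x \<bullet> (Q1 *v x) + u \<bullet> (R1 *v u) + r \<bullet> x + v \<bullet> u + c)"
    unfolding stage_cost_mean_fluctuation[OF X U] x_def[symmetric] u_def[symmetric] by simp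
qed

section \<open>Consequences of strict dissipativity\<close>

text \<open>
  Deterministic translations generate no information; hence a translated process is adapted to
  the filtration of the original one.
\<close>

lemma natural_filtration_translate:
  fixes X :: "nat \<Rightarrow> 'w \<Rightarrow> 'b::real_normed_vector"
  shows "natural_filtration M (\<lambda>k \<omega>. X k \<omega> + a k) = natural_filtration M X"
proof -
  have "sets (vimage_algebra (space M) (\<lambda>\<omega>. X i \<omega> + a i) borel)
      = sets (vimage_algebra (space M) (X i) borel)" for i
  proof
    have "(\<lambda>x. x + b) \<in> borel_measurable borel" for b :: 'b
      by (intro borel_measurable_continuous_onI continuous_intros)
    note sub = sets_vimage_algebra_compose_subset[OF this]
    show "sets (vimage_algebra (space M) (\<lambda>\<omega>. X i \<omega> + a i) borel)
        \<subseteq> sets (vimage_algebra (space M) (X i) borel)"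
      by (rule sub) simp
    show "sets (vimage_algebra (space M) (X i) borel)
        \<subseteq> sets (vimage_algebra (space M) (\<lambda>\<omega>. X i \<omega> + a i) borel)"
      using sub[of "\<lambda>\<omega>. X i \<omega> + a i" "space M" "- a i"] by simp
  qed
  then show ?thesis by (auto simp: natural_filtration_def)
qed

text \<open>
  Adding a deterministic trajectory of \<open>x\<^sup>+ = A x + B u\<close>, started at \<open>y\<close> with first input
  \<open>w\<close> and zero input afterwards, to \<open>xs + Xh\<close> gives an admissible process of the original system,
  and the difference that enters the dissipation inequality is the constant \<open>y\<close>.  The predicate
  \<open>D\<close> stands for that inequality.
\<close>

lemma (in prob_space) dissipativity_deterministic:
  fixes A :: "real^'n^'n" and B :: "real^'l^'n" and E :: "real^'m^'n"
    and Xh :: "nat \<Rightarrow> 'a \<Rightarrow> real^'n" and Uh :: "nat \<Rightarrow> 'a \<Rightarrow> real^'l"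
  assumes steady: "(mat 1 - A) *v xs - B *v us = E *v \<mu> + z"
    and hat: "admissible_process M (dynamics A B E 0) (\<lambda>k \<omega>. W k \<omega> - \<mu>) Xh Uh"
    and diss: "\<And>X U. admissible_process M (dynamics A B E z) W X U \<Longrightarrow>
      D (\<lambda>\<omega>. X 0 \<omega> - xs - Xh 0 \<omega>) (\<lambda>\<omega>. U 0 \<omega> - us - Uh 0 \<omega>)"
  shows "D (\<lambda>_. y) (\<lambda>_. w)"
proof -
  define ud :: "nat \<Rightarrow> real^'l" where "ud k = (if k = 0 then w else 0)" for k
  define xd :: "nat \<Rightarrow> real^'n" where "xd = rec_nat y (\<lambda>k x. A *v x + B *v ud k)"
  have xd: "xd 0 = y" "xd (Suc k) = A *v xd k + B *v ud k" for k by (simp_all add: xd_def)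
  let ?X = "\<lambda>k \<omega>. Xh k \<omega> + (xs + xd k)" and ?U = "\<lambda>k \<omega>. Uh k \<omega> + (us + ud k)"
  have h: "Xh k \<in> L2 M (natural_filtration M Xh k)" "Uh k \<in> L2 M (natural_filtration M Xh k)"
    "indep_rvs M (\<lambda>\<omega>. W k \<omega> - \<mu>) (\<lambda>\<omega>. (Xh k \<omega>, Uh k \<omega>))"
    "AE \<omega> in M. Xh (Suc k) \<omega> = dynamics A B E 0 (Xh k \<omega>) (Uh k \<omega>) (W k \<omega> - \<mu>)" for k
    using hat unfolding admissible_process_def by blast+
  have "admissible_process M (dynamics A B E z) W ?X ?U"
    unfolding admissible_process_def natural_filtration_translate
  proof (intro allI conjI)
    fix k
    show "?X k \<in> L2 M (natural_filtration M Xh k)" "?U k \<in> L2 M (natural_filtration M Xh k)"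
      using h(1,2)[of k] L2D(4)[OF h(1)] by (auto intro!: L2_add L2_const)
    have "indep_rvs M (\<lambda>\<omega>. (\<lambda>v. v + \<mu>) (W k \<omega> - \<mu>))
        (\<lambda>\<omega>. (\<lambda>p. (fst p + (xs + xd k), snd p + (us + ud k))) (Xh k \<omega>, Uh k \<omega>))"
      by (intro indep_rvs_compose[OF h(3)] borel_measurable_continuous_onI continuous_intros)
    then show "indep_rvs M (W k) (\<lambda>\<omega>. (?X k \<omega>, ?U k \<omega>))" by simp
    have "xs = A *v xs + B *v us + E *v \<mu> + z"
      using steady by (simp add: matrix_vector_mult_diff_rdistrib algebra_simps)
    then have "dynamics A B E 0 x u (n - \<mu>) + (xs + xd (Suc k))
        = dynamics A B E z (x + (xs + xd k)) (u + (us + ud k)) n" for x u n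
      by (simp add: dynamics_def xd matrix_vector_right_distrib matrix_vector_mult_diff_distrib algebra_simps)
    then show "AE \<omega> in M. ?X (Suc k) \<omega> = dynamics A B E z (?X k \<omega>) (?U k \<omega>) (W k \<omega>)"
      using h(4)[of k] by auto
  qed
  from diss[OF this] show ?thesis by (simp add: xd ud_def)
qed

lemma class_K_inf_pos: "class_K_inf \<alpha> \<Longrightarrow> 0 < s \<Longrightarrow> 0 < \<alpha> s"
  unfolding class_K_inf_def strict_mono_on_def by (metis atLeast_iff less_imp_le order_refl)

text \<open>
  The slack of the dissipation inequality is a quadratic function of \<open>(y, w)\<close> that vanishes at
  the equilibrium \<open>(xt, ut)\<close>.  Adding the inequalities at \<open>xt + y\<close> and \<open>xt - y\<close> removes its
  linear part, and the lower bound \<open>\<alpha> (\<parallel>y\<parallel>\<^sup>2)\<close> remains positive.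
\<close>

lemma dissipativity_strict_quadratic:
  fixes A Q S :: "real^'n^'n" and B :: "real^'l^'n" and R :: "real^'l^'l"
  assumes \<alpha>: "class_K_inf \<alpha>" and eq: "A *v xt + B *v ut = xt"
    and diss: "\<And>y w. \<alpha> ((norm (y - xt))\<^sup>2)
      \<le> (y \<bullet> (Q *v y) + w \<bullet> (R *v w) + r \<bullet> y + v \<bullet> w + c)
        - (xt \<bullet> (Q *v xt) + ut \<bullet> (R *v ut) + r \<bullet> xt + v \<bullet> ut + c)
        + (y \<bullet> (S *v y) + q \<bullet> y)
        - ((A *v y + B *v w) \<bullet> (S *v (A *v y + B *v w)) + q \<bullet> (A *v y + B *v w))"
    and "y \<noteq> 0"
  shows "(A *v y + B *v w) \<bullet> (S *v (A *v y + B *v w))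
    < y \<bullet> (Q *v y) + w \<bullet> (R *v w) + y \<bullet> (S *v y)"
proof -
  let ?z = "A *v y + B *v w"
  have next_pm: "A *v (xt + y) + B *v (ut + w) = xt + ?z" "A *v (xt - y) + B *v (ut - w) = xt - ?z"
    using eq by (simp_all add: matrix_vector_right_distrib matrix_vector_mult_diff_distrib algebra_simps)
  have "0 < \<alpha> ((norm y)\<^sup>2)" using \<open>y \<noteq> 0\<close> by (intro class_K_inf_pos[OF \<alpha>]) simp
  moreover note diss[of "xt + y" "ut + w"] diss[of "xt - y" "ut - w"]
  ultimately show ?thesis
    using quadratic_form_symmetrize[of xt y Q] quadratic_form_symmetrize[of ut w R]
      quadratic_form_symmetrize[of xt y S] quadratic_form_symmetrize[of xt ?z S]
    unfolding next_pm by (simp add: inner_add_right inner_diff_right)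
qed

section \<open>The optimal stationary distribution\<close>

theorem theorem5p2:
  fixes A :: "real^'n^'n" and B :: "real^'l^'n" and E :: "real^'m^'n" and z :: "real^'n"
    and M :: "'w measure" and W :: "nat \<Rightarrow> 'w \<Rightarrow> real^'m"
    and \<rho>W :: "(real^'m) measure" and \<mu>W :: "real^'m"
    and Q1 Q2 Q1_half P S :: "real^'n^'n" and R1 R2 :: "real^'l^'l"
    and r :: "real^'n" and v :: "real^'l" and c :: real
    and xs :: "real^'n" and us :: "real^'l"
    and K :: "real^'n^'l"
    and r_hat :: "real^'n" and v_hat :: "real^'l" and c_hat :: real
    and X_hat :: "nat \<Rightarrow> 'w \<Rightarrow> real^'n" and U_hat :: "nat \<Rightarrow> 'w \<Rightarrow> real^'l"
    and \<rho>_hat :: "(real^'n) measure"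
    and xt :: "real^'n" and ut :: "real^'l"
    and \<alpha> :: "real \<Rightarrow> real" and q :: "real^'n"
    and X_star :: "nat \<Rightarrow> 'w \<Rightarrow> real^'n" and U_star :: "nat \<Rightarrow> 'w \<Rightarrow> real^'l"
    and \<rho>_star :: "(real^'n) measure" and j :: nat
  assumes stab: "stabilizable A B"
    \<comment> \<open>the noise sequence\<close>
    and M: "prob_space M"
    and W_L2: "\<forall>k. W k \<in> L2 M M"
    and W_indep: "prob_space.indep_vars M (\<lambda>_. borel) W UNIV"
    and W_law: "\<forall>k. distr M borel (W k) = \<rho>W"
    and W_mean: "\<mu>W = (\<integral>w. w \<partial>\<rho>W)"
    \<comment> \<open>the stage cost\<close>
    and weights: "psd Q1" "psd Q2" "pos_def R1" "psd R2"
    \<comment> \<open>hypotheses of the theorem; \<open>Q1_half\<close> is the positive semidefinite square root of \<open>Q1\<close>\<close>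
    and steady: "(mat 1 - A) *v xs - B *v us = E *v \<mu>W + z"
    and Q1_half: "psd Q1_half" "Q1_half ** Q1_half = Q1"
    and detect: "detectable A Q1_half"
    \<comment> \<open>Riccati solution and gain\<close>
    and P_psd: "psd P"
    and P: "P = transpose A ** P ** A + (Q1 + Q2)
      - transpose A ** P ** B ** matrix_inv ((R1 + R2) + transpose B ** P ** B)
        ** transpose B ** P ** A"
    and K: "K = - (matrix_inv ((R1 + R2) + transpose B ** P ** B) ** transpose B ** P ** A)"
    \<comment> \<open>shifted cost\<close>
    and r_hat: "r_hat = r + 2 *\<^sub>R (Q1 *v xs)"
    and v_hat: "v_hat = v + 2 *\<^sub>R (R1 *v us)"
    and c_hat: "c_hat = xs \<bullet> (Q1 *v xs) + us \<bullet> (R1 *v us) + r \<bullet> xs + v \<bullet> us + c"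
    \<comment> \<open>stationary process of the system with centred noise\<close>
    and U_hat: "\<forall>k. U_hat k = (\<lambda>\<omega>. K *v X_hat k \<omega>)"
    and X_hat: "admissible_process M (dynamics A B E 0) (\<lambda>k \<omega>. W k \<omega> - \<mu>W) X_hat U_hat"
    and \<rho>_hat: "\<rho>_hat \<in> P2" "(\<integral>x. x \<partial>\<rho>_hat) = 0" "\<forall>k. distr M borel (X_hat k) = \<rho>_hat"
    \<comment> \<open>strict dissipativity\<close>
    and tilde: "(mat 1 - A) *v xt - B *v ut = 0"
    and \<alpha>: "class_K_inf \<alpha>"
    and S: "pos_def S"
    and dissipativity: "\<forall>X U k. admissible_process M (dynamics A B E z) W X U \<longrightarrow>
      (let X_tilde = (\<lambda>\<omega>. X k \<omega> - xs - X_hat k \<omega>);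
           U_tilde = (\<lambda>\<omega>. U k \<omega> - us - U_hat k \<omega>);
           X_tilde_next = (\<lambda>\<omega>. A *v X_tilde \<omega> + B *v U_tilde \<omega>)
       in stage_cost M Q1 Q2 R1 R2 r_hat v_hat c_hat X_tilde U_tilde
          - stage_cost M Q1 Q2 R1 R2 r_hat v_hat c_hat (\<lambda>_. xt) (\<lambda>_. ut)
          + storage M S q X_tilde - storage M S q X_tilde_next
          \<ge> \<alpha> (\<integral>\<omega>. (norm (X_tilde \<omega> - xt))\<^sup>2 \<partial>M))"
    \<comment> \<open>the stationary pair; its law does not depend on the time \<open>j\<close>\<close>
    and X_star_0: "X_star 0 = (\<lambda>\<omega>. X_hat 0 \<omega> + xs + xt)"
    and X_star_Suc: "\<forall>k. X_star (Suc k) = (\<lambda>\<omega>. dynamics A B E z (X_star k \<omega>) (U_star k \<omega>) (W k \<omega>))"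
    and U_star: "\<forall>k. U_star k = (\<lambda>\<omega>. K *v (X_star k \<omega> - xt - xs) + ut + us)"
    and \<rho>_star: "\<rho>_star = distr M borel (X_star j)"
  shows "stationary_solution M (dynamics A B E z) \<rho>W (stage_cost M Q1 Q2 R1 R2 r v c)
           \<rho>_star (\<lambda>x. K *v (x - xt - xs) + ut + us)
    \<and> (\<forall>\<rho>' \<pi>'.
         stationary_solution M (dynamics A B E z) \<rho>W (stage_cost M Q1 Q2 R1 R2 r v c) \<rho>' \<pi>'
         \<longrightarrow> \<rho>' = \<rho>_star)"
proof -
  interpret prob_space M by fact
  define f where "f = dynamics A B E z"
  define Q R G where "Q = Q1 + Q2" and "R = R1 + R2" and "G = R + transpose B ** P ** B"
  define N where "N n = E *v (n - \<mu>W)" for n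
  define d where "d = E *v \<mu>W + z"
  define \<tau> where "\<tau> = (\<integral>n. N n \<bullet> (P *v N n) \<partial>\<rho>W)"
  define g where "g x u = x \<bullet> (Q1 *v x) + u \<bullet> (R1 *v u) + r \<bullet> x + v \<bullet> u + c" for x u
  define \<pi> where "\<pi> x = K *v (x - xt - xs) + ut + us" for x
  define cost where "cost = stage_cost M Q1 Q2 R1 R2 r v c"
  have f_eq: "f x u n = A *v x + B *v u + N n + d" for x u n
    by (simp add: f_def dynamics_def N_def d_def matrix_vector_mult_diff_distrib)
  have N_meas [measurable]: "N \<in> borel_measurable borel"
    unfolding N_def by measurable
  have R_pos: "pos_def R"
    unfolding R_def using weights(3,4) by (rule pos_def_add_psd)
  note riccati = riccati_complete_square[OF R_pos P_psd, folded G_def, of A Q B K]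
  have square: "x \<bullet> ((Q1 + Q2) *v x) + u \<bullet> ((R1 + R2) *v u) + (A *v x + B *v u) \<bullet> (P *v (A *v x + B *v u))
      = x \<bullet> (P *v x) + (u - K *v x) \<bullet> (G *v (u - K *v x))" for x u
    using riccati P K by (simp add: Q_def R_def G_def)
  have G_pos: "0 < w \<bullet> (G *v w)" if "w \<noteq> 0" for w
    unfolding G_def using R_pos P_psd that by (rule riccati_weight_pos)
  have G_nonneg: "0 \<le> w \<bullet> (G *v w)" for w
    using G_pos[of w] by (cases "w = 0") auto

  \<comment> \<open>\<open>r_hat\<close>, \<open>v_hat\<close>, \<open>c_hat\<close> are the coefficients of the mean cost \<open>g\<close> expanded around \<open>(xs, us)\<close>, so
    the deterministic dissipation inequality can be read as an inequality for \<open>g\<close>.\<close>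
  have Q1_sym: "x \<bullet> (Q1 *v y) = y \<bullet> (Q1 *v x)" for x y
    using weights(1) by (intro symmetric_matrix_inner) (simp add: psd_def)
  have R1_sym: "x \<bullet> (R1 *v y) = y \<bullet> (R1 *v x)" for x y
    using weights(3) by (intro symmetric_matrix_inner) (simp add: pos_def_def)
  have shift: "g (xs + y) (us + w)
      = y \<bullet> (Q1 *v y) + w \<bullet> (R1 *v w) + r_hat \<bullet> y + v_hat \<bullet> w + c_hat" for y w
    using Q1_sym[of xs y] R1_sym[of us w]
    by (simp add: g_def r_hat v_hat c_hat matrix_vector_right_distrib inner_add inner_commute)
  have diss: "\<alpha> ((norm (y - xt))\<^sup>2)
      \<le> g (xs + y) (us + w) - g (xs + xt) (us + ut) + (y \<bullet> (S *v y) + q \<bullet> y)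
        - ((A *v y + B *v w) \<bullet> (S *v (A *v y + B *v w)) + q \<bullet> (A *v y + B *v w))" for y w
    using dissipativity_deterministic[OF steady X_hat, of
        "\<lambda>Y V. stage_cost M Q1 Q2 R1 R2 r_hat v_hat c_hat Y V
          - stage_cost M Q1 Q2 R1 R2 r_hat v_hat c_hat (\<lambda>_. xt) (\<lambda>_. ut)
          + storage M S q Y - storage M S q (\<lambda>\<omega>. A *v Y \<omega> + B *v V \<omega>)
          \<ge> \<alpha> (\<integral>\<omega>. (norm (Y \<omega> - xt))\<^sup>2 \<partial>M)" y w]
      dissipativity
    by (simp add: Let_def stage_cost_deterministic storage_deterministic shift prob_space)
  have xt_eq: "A *v xt + B *v ut = xt"
    using tilde by (simp add: matrix_vector_mult_diff_rdistrib algebra_simps)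
  \<comment> \<open>For a steady state \<open>(x, u)\<close>, the deviation \<open>x - xs\<close> is its own successor, and the storage
    terms cancel.\<close>
  have means: "\<alpha> ((norm (x - (xs + xt)))\<^sup>2) \<le> g x u - g (xs + xt) (us + ut)"
    if "A *v x + B *v u + d = x" for x u
  proof -
    have xs_eq: "A *v xs + B *v us + d = xs"
      using steady by (simp add: d_def matrix_vector_mult_diff_rdistrib algebra_simps)
    have "A *v (x - xs) + B *v (u - us) = (A *v x + B *v u + d) - (A *v xs + B *v us + d)"
      by (simp add: matrix_vector_mult_diff_distrib)
    then have next_eq: "A *v (x - xs) + B *v (u - us) = x - xs"
      unfolding that xs_eq .
    have "xs + (x - xs) = x" "us + (u - us) = u" by simp_all
    then show ?thesis using diss[of "x - xs" "u - us", unfolded next_eq] by (simp add: diff_diff_eq)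
  qed
  have \<alpha>_nonneg: "0 \<le> \<alpha> (t\<^sup>2)" for t
    using class_K_inf_pos[OF \<alpha>, of "t\<^sup>2"] \<alpha> by (cases "t = 0") (auto simp: class_K_inf_def)

  \<comment> \<open>Along \<open>F = A + B K\<close>, the form of \<open>S\<close> grows by less than the cost with weights \<open>Q1\<close>, \<open>R1\<close>, and that of \<open>P\<close>
    decreases by the cost with weights \<open>Q1 + Q2\<close>, \<open>R1 + R2\<close>, which is at least as
    large; so the form of \<open>S + P\<close> decreases strictly.\<close>
  define F where "F = A + B ** K"
  have F_eq: "F *v y = A *v y + B *v (K *v y)" for y
    by (simp add: F_def matrix_vector_mult_add_rdistrib matrix_vector_mul_assoc)
  have contract: "(F *v y) \<bullet> ((S + P) *v (F *v y)) < y \<bullet> ((S + P) *v y)" if "y \<noteq> 0" for y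
  proof -
    have "(F *v y) \<bullet> (S *v (F *v y)) < y \<bullet> (Q1 *v y) + (K *v y) \<bullet> (R1 *v (K *v y)) + y \<bullet> (S *v y)"
      using dissipativity_strict_quadratic[OF \<alpha> xt_eq diss[unfolded shift] that, of "K *v y"]
      by (simp add: F_eq)
    moreover have "y \<bullet> (Q *v y) + (K *v y) \<bullet> (R *v (K *v y)) + (F *v y) \<bullet> (P *v (F *v y)) = y \<bullet> (P *v y)"
      using square[of y "K *v y"] by (simp add: F_eq Q_def R_def)
    moreover have "0 \<le> y \<bullet> (Q2 *v y)" "0 \<le> (K *v y) \<bullet> (R2 *v (K *v y))"
      using weights by (auto simp: psd_def)
    ultimately show ?thesis
      by (simp add: Q_def R_def matrix_vector_mult_add_rdistrib inner_add_right)
  qed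
  have pos: "0 < y \<bullet> ((S + P) *v y)" if "y \<noteq> 0" for y
    using pos_def_add_psd[OF S P_psd] that by (simp add: pos_def_def)
  obtain C \<rho> where decay: "0 \<le> \<rho>" "\<rho> < 1"
      "\<And>k y. norm (((*v) F ^^ k) y) \<le> C * \<rho> ^ k * norm y"
    by (rule strict_lyapunov_decay[OF pos contract]) (assumption | rule that)+

  \<comment> \<open>The law of \<open>N\<close> is determined by \<open>\<rho>W\<close>, so its energy \<open>\<tau>\<close> is the same for all witnesses.\<close>
  have noise: "(\<lambda>\<omega>. N (V \<omega>)) \<in> L2 M M" "expectation (\<lambda>\<omega>. N (V \<omega>)) = 0"
      "expectation (\<lambda>\<omega>. N (V \<omega>) \<bullet> (P *v N (V \<omega>))) = \<tau>"
      "distr M borel (\<lambda>\<omega>. N (V \<omega>)) = distr \<rho>W borel N"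
    if V: "V \<in> L2 M M" "distr M borel V = \<rho>W" for V
  proof -
    note [measurable] = L2D(2)[OF V(1)]
    have mean: "\<mu>W = expectation V"
      unfolding W_mean V(2)[symmetric] by (simp add: integral_distr)
    show "(\<lambda>\<omega>. N (V \<omega>)) \<in> L2 M M"
      unfolding N_def using V(1) by (intro L2_intros)
    show "expectation (\<lambda>\<omega>. N (V \<omega>)) = 0"
      unfolding N_def using L2_integrable[OF V(1)]
      by (subst expectation_matrix_vector_mult) (simp_all add: mean prob_space)
    show "expectation (\<lambda>\<omega>. N (V \<omega>) \<bullet> (P *v N (V \<omega>))) = \<tau>"
      unfolding \<tau>_def V(2)[symmetric] by (subst integral_distr) simp_all
    show "distr M borel (\<lambda>\<omega>. N (V \<omega>)) = distr \<rho>W borel N"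
      unfolding V(2)[symmetric] by (subst distr_distr) (simp_all add: comp_def)
  qed

  have witness_indep: "indep_var borel (\<lambda>\<omega>. h (X \<omega>)) borel (\<lambda>\<omega>. N (V \<omega>))"
    if wit: "stationary_witness M f \<rho>W \<rho>' \<pi>' X V" and h: "h \<in> borel_measurable borel"
    for \<rho>' \<pi>' X V and h :: "real^'n \<Rightarrow> real^'n"
  proof -
    have "X \<in> L2 M M" "V \<in> L2 M M" using wit by (simp_all add: stationary_witness_def)
    then show ?thesis
      using wit h N_meas by (intro indep_var_of_indep_rvs) (simp_all add: stationary_witness_def L2D(2))
  qed

  \<comment> \<open>The cost formula, read off from an arbitrary witness of feasibility.\<close>
  have witness: "X \<in> L2 M M" "\<pi>' \<circ> X \<in> L2 M M" "V \<in> L2 M M" "distr M borel V = \<rho>W"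
      "A *v expectation X + B *v expectation (\<pi>' \<circ> X) + d = expectation X"
      "cost X (\<pi>' \<circ> X) = \<tau>
        + expectation (\<lambda>\<omega>. ((\<pi>' \<circ> X) \<omega> - expectation (\<pi>' \<circ> X) - K *v (X \<omega> - expectation X))
          \<bullet> (G *v ((\<pi>' \<circ> X) \<omega> - expectation (\<pi>' \<circ> X) - K *v (X \<omega> - expectation X))))
        + g (expectation X) (expectation (\<pi>' \<circ> X))"
      "distr M borel (\<lambda>\<omega>. A *v X \<omega> + B *v (\<pi>' \<circ> X) \<omega> + N (V \<omega>) + d) = distr M borel X"
    if \<pi>': "\<pi>' \<in> feedbacks M" and wit: "stationary_witness M f \<rho>W \<rho>' \<pi>' X V"
    for \<rho>' \<pi>' X V
  proof -
    show X: "X \<in> L2 M M" and V: "V \<in> L2 M M" "distr M borel V = \<rho>W"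
      using wit by (simp_all add: stationary_witness_def)
    show U: "\<pi>' \<circ> X \<in> L2 M M" using \<pi>' X by (auto simp: feedbacks_def)
    show stat: "distr M borel (\<lambda>\<omega>. A *v X \<omega> + B *v (\<pi>' \<circ> X) \<omega> + N (V \<omega>) + d) = distr M borel X"
      using wit by (simp add: stationary_witness_def f_eq)
    have [measurable]: "\<pi>' \<in> borel_measurable borel" using \<pi>' by (simp add: feedbacks_def)
    have "indep_var borel (\<lambda>\<omega>. A *v X \<omega> + B *v (\<pi>' \<circ> X) \<omega>) borel (\<lambda>\<omega>. N (V \<omega>))"
      using witness_indep[OF wit, of "\<lambda>x. A *v x + B *v \<pi>' x"] by simp
    note sc = stationary_cost[OF X U noise(1)[OF V] this noise(2)[OF V] stat square]
    show "A *v expectation X + B *v expectation (\<pi>' \<circ> X) + d = expectation X" by (rule sc(1))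
    show "cost X (\<pi>' \<circ> X) = \<tau>
        + expectation (\<lambda>\<omega>. ((\<pi>' \<circ> X) \<omega> - expectation (\<pi>' \<circ> X) - K *v (X \<omega> - expectation X))
          \<bullet> (G *v ((\<pi>' \<circ> X) \<omega> - expectation (\<pi>' \<circ> X) - K *v (X \<omega> - expectation X))))
        + g (expectation X) (expectation (\<pi>' \<circ> X))"
      using sc(2)[of r v c] unfolding g_def cost_def noise(3)[OF V] .
  qed

  \<comment> \<open>The candidate \<open>X_star\<close> is \<open>X_hat\<close> translated by \<open>xs + xt\<close>: the affine feedback \<open>\<pi>\<close> is \<open>K\<close> in the
    translated coordinate.  The two agree only almost surely, because the equation of \<open>X_hat\<close> holds
    almost surely.\<close>
  have Xh: "X_hat k \<in> L2 M M" "indep_rvs M (\<lambda>\<omega>. W k \<omega> - \<mu>W) (\<lambda>\<omega>. (X_hat k \<omega>, U_hat k \<omega>))"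
      "AE \<omega> in M. X_hat (Suc k) \<omega> = F *v X_hat k \<omega> + N (W k \<omega>)" for k
  proof -
    have adm: "X_hat k \<in> L2 M (natural_filtration M X_hat k)"
        "indep_rvs M (\<lambda>\<omega>. W k \<omega> - \<mu>W) (\<lambda>\<omega>. (X_hat k \<omega>, U_hat k \<omega>))"
        "AE \<omega> in M. X_hat (Suc k) \<omega> = dynamics A B E 0 (X_hat k \<omega>) (U_hat k \<omega>) (W k \<omega> - \<mu>W)"
      using X_hat unfolding admissible_process_def by blast+
    show "X_hat k \<in> L2 M M" by (rule L2D(5)[OF adm(1)])
    show "indep_rvs M (\<lambda>\<omega>. W k \<omega> - \<mu>W) (\<lambda>\<omega>. (X_hat k \<omega>, U_hat k \<omega>))" by (fact adm(2))
    show "AE \<omega> in M. X_hat (Suc k) \<omega> = F *v X_hat k \<omega> + N (W k \<omega>)"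
      using adm(3) by (simp add: U_hat dynamics_def F_eq N_def)
  qed
  have W: "W k \<in> L2 M M" "distr M borel (W k) = \<rho>W" for k using W_L2 W_law by auto
  have center: "A *v (xs + xt) + B *v (us + ut) + d = xs + xt"
    using steady xt_eq
    by (simp add: d_def matrix_vector_mult_diff_rdistrib matrix_vector_right_distrib algebra_simps)
  have f_center: "f (x + (xs + xt)) (\<pi> (x + (xs + xt))) n = F *v x + N n + (xs + xt)" for x n
  proof -
    have "\<pi> (x + (xs + xt)) = K *v x + (us + ut)" by (simp add: \<pi>_def algebra_simps)
    then have "f (x + (xs + xt)) (\<pi> (x + (xs + xt))) n
        = F *v x + N n + (A *v (xs + xt) + B *v (us + ut) + d)"
      by (simp add: f_eq F_eq matrix_vector_right_distrib)
    then show ?thesis unfolding center .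
  qed
  have star_ae: "AE \<omega> in M. X_star k \<omega> = X_hat k \<omega> + (xs + xt)" and star_L2: "X_star k \<in> L2 M M" for k
  proof (induction k)
    case 0
    {
      case 1 show ?case by (simp add: X_star_0 add.assoc)
    next
      case 2 show ?case using Xh(1) by (auto simp: X_star_0 intro!: L2_intros)
    }
  next
    case (Suc k)
    have step: "X_star (Suc k) \<omega> = f (X_star k \<omega>) (\<pi> (X_star k \<omega>)) (W k \<omega>)" for \<omega>
      by (simp add: X_star_Suc U_star f_def \<pi>_def)
    {
      case 1
      show ?case using Suc(1) Xh(3)[of k] by eventually_elim (simp add: step f_center)
    next
      case 2
      have "X_star (Suc k) = (\<lambda>\<omega>. A *v X_star k \<omega>
          + B *v (K *v (X_star k \<omega> - xt - xs) + ut + us) + E *v W k \<omega> + z)"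
        by (simp add: X_star_Suc U_star dynamics_def)
      then show ?case using Suc(2) W(1)[of k] by (auto intro!: L2_intros)
    }
  qed
  let ?X = "\<lambda>\<omega>. X_hat 0 \<omega> + (xs + xt)"
  have law_shift: "distr M borel (\<lambda>\<omega>. Y \<omega> + a) = distr (distr M borel Y) borel (\<lambda>x. x + a)"
    if "Y \<in> borel_measurable M" for Y and a :: "real^'n"
    using that by (subst distr_distr) (simp_all add: comp_def)
  have \<rho>_star_shift: "\<rho>_star = distr \<rho>_hat borel (\<lambda>x. x + (xs + xt))"
  proof -
    have "\<rho>_star = distr M borel (\<lambda>\<omega>. X_hat j \<omega> + (xs + xt))"
      unfolding \<rho>_star using star_ae[of j] L2D(2)[OF star_L2[of j]] L2D(2)[OF Xh(1)[of j]]
      by (intro distr_cong_AE) auto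
    also have "\<dots> = distr \<rho>_hat borel (\<lambda>x. x + (xs + xt))"
      using law_shift[OF L2D(2)[OF Xh(1)[of j]]] \<rho>_hat(3) by simp
    finally show ?thesis .
  qed
  have X_L2: "?X \<in> L2 M M" using Xh(1) by (intro L2_intros)
  have law_X: "distr M borel ?X = \<rho>_star"
    using law_shift[OF L2D(2)[OF Xh(1)]] \<rho>_hat(3) \<rho>_star_shift by simp
  have \<pi>_meas: "\<pi> \<in> borel_measurable borel" unfolding \<pi>_def by measurable
  have \<pi>_feedback: "\<pi> \<in> feedbacks M"
    unfolding feedbacks_def
  proof (intro CollectI conjI allI ballI \<pi>_meas)
    fix H and Y :: "'w \<Rightarrow> real^'n" assume Y: "Y \<in> L2 M H"
    then show "\<pi> \<circ> Y \<in> L2 M H"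
      unfolding \<pi>_def comp_def using L2D(4)[OF Y]
      by (intro L2_add L2_diff L2_matrix_vector_mult L2_const)
  qed
  have X_wit: "stationary_witness M f \<rho>W \<rho>_star \<pi> ?X (W 0)"
    unfolding stationary_witness_def
  proof (intro conjI X_L2 W law_X)
    have "indep_rvs M (\<lambda>\<omega>. (\<lambda>v. v + \<mu>W) (W 0 \<omega> - \<mu>W))
        (\<lambda>\<omega>. (\<lambda>p. fst p + (xs + xt)) (X_hat 0 \<omega>, U_hat 0 \<omega>))"
      by (intro indep_rvs_compose[OF Xh(2)] borel_measurable_continuous_onI continuous_intros)
    then show "indep_rvs M ?X (W 0)" by (simp add: indep_rvs_commute)
    have "distr M borel (\<lambda>\<omega>. f (?X \<omega>) ((\<pi> \<circ> ?X) \<omega>) (W 0 \<omega>))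
        = distr M borel (\<lambda>\<omega>. X_hat 1 \<omega> + (xs + xt))"
      using Xh(3)[of 0] L2D(2)[OF Xh(1)] L2D(2)[OF W(1)]
      by (intro distr_cong_AE) (auto simp: f_center)
    also have "\<dots> = \<rho>_star"
      using law_shift[OF L2D(2)[OF Xh(1)]] \<rho>_hat(3) \<rho>_star_shift by simp
    finally show "distr M borel (\<lambda>\<omega>. f (?X \<omega>) ((\<pi> \<circ> ?X) \<omega>) (W 0 \<omega>)) = \<rho>_star" .
  qed
  have law_P2: "distr M borel Y \<in> P2" if "Y \<in> L2 M M" for Y :: "'w \<Rightarrow> real^'n"
    using that L2D[OF that] by (simp add: P2_def prob_space_distr integrable_distr_eq)
  have feasible: "stationary_feasible M f \<rho>W \<rho>_star \<pi>"
    unfolding stationary_feasible_def using \<pi>_feedback X_wit law_P2[OF X_L2] law_X by auto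
  have star_cost: "cost X (\<pi> \<circ> X) = \<tau> + g (xs + xt) (us + ut)"
    if wit: "stationary_witness M f \<rho>W \<rho>_star \<pi> X V" for X V
  proof -
    note w = witness[OF \<pi>_feedback wit]
    note [measurable] = L2D(2)[OF w(1)]
    have "expectation X = integral\<^sup>L \<rho>_star (\<lambda>x. x)"
      using wit by (auto simp: stationary_witness_def integral_distr)
    also have "\<dots> = expectation ?X"
      unfolding law_X[symmetric] using L2D(2)[OF X_L2] by (simp add: integral_distr)
    also have "\<dots> = xs + xt"
    proof -
      have "expectation (X_hat 0) = integral\<^sup>L \<rho>_hat (\<lambda>x. x)"
        using L2D(2)[OF Xh(1)[of 0]] \<rho>_hat(3)[THEN spec, of 0, symmetric] by (simp add: integral_distr)
      then show ?thesis using \<rho>_hat(2) L2_integrable[OF Xh(1)[of 0]] by (simp add: prob_space)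
    qed
    finally have EX: "expectation X = xs + xt" .
    have "expectation (\<pi> \<circ> X) = expectation (\<lambda>\<omega>. K *v (X \<omega> - (xs + xt)) + (us + ut))"
      by (simp add: \<pi>_def comp_def algebra_simps)
    also have "\<dots> = K *v (expectation X - (xs + xt)) + (us + ut)"
      using w(1) L2_integrable[OF w(1)]
      by (subst Bochner_Integration.integral_add)
        (auto intro!: L2_integrable[of _ M] L2_intros simp: prob_space expectation_matrix_vector_mult)
    finally have EU: "expectation (\<pi> \<circ> X) = us + ut" by (simp add: EX)
    have "(\<pi> \<circ> X) \<omega> - (us + ut) - K *v (X \<omega> - (xs + xt)) = 0" for \<omega>
      by (simp add: \<pi>_def algebra_simps)
    then show ?thesis using w(6) unfolding EX EU by simp
  qed
  have lower: "cost X (\<pi>' \<circ> X) \<ge> \<tau> + g (xs + xt) (us + ut)"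
    if "\<pi>' \<in> feedbacks M" "stationary_witness M f \<rho>W \<rho>' \<pi>' X V" for \<rho>' \<pi>' X V
  proof -
    note w = witness[OF that]
    have "0 \<le> expectation (\<lambda>\<omega>. ((\<pi>' \<circ> X) \<omega> - expectation (\<pi>' \<circ> X) - K *v (X \<omega> - expectation X))
          \<bullet> (G *v ((\<pi>' \<circ> X) \<omega> - expectation (\<pi>' \<circ> X) - K *v (X \<omega> - expectation X))))"
      by (intro Bochner_Integration.integral_nonneg G_nonneg)
    then show ?thesis using w(6) means[OF w(5)] \<alpha>_nonneg[of "norm (expectation X - (xs + xt))"] by linarith
  qed
  have opt: "stationary_solution M f \<rho>W cost \<rho>_star \<pi>"
    unfolding stationary_solution_def
  proof (intro conjI feasible allI impI, elim conjE)
    fix \<rho>' \<pi>' X V X' V'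
    assume "stationary_witness M f \<rho>W \<rho>_star \<pi> X V"
      and "stationary_feasible M f \<rho>W \<rho>' \<pi>'" "stationary_witness M f \<rho>W \<rho>' \<pi>' X' V'"
    then show "cost X (\<pi> \<circ> X) \<le> cost X' (\<pi>' \<circ> X')"
      using star_cost[of X V] lower[of \<pi>' \<rho>' X' V'] by (simp add: stationary_feasible_def)
  qed

  have unique: "\<rho>' = \<rho>_star" if sol: "stationary_solution M f \<rho>W cost \<rho>' \<pi>'" for \<rho>' \<pi>'
  proof -
    obtain X V where \<pi>': "\<pi>' \<in> feedbacks M" and wit: "stationary_witness M f \<rho>W \<rho>' \<pi>' X V"
      using sol by (auto simp: stationary_solution_def stationary_feasible_def)
    note w0 = witness[OF \<pi>' wit]
    define x u where "x = expectation X" and "u = expectation (\<pi>' \<circ> X)"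
    define D where "D \<omega> = (\<pi>' \<circ> X) \<omega> - u - K *v (X \<omega> - x)" for \<omega>
    have D_L2: "D \<in> L2 M M" unfolding D_def using w0(1,2) by (intro L2_intros)
    have D_nonneg: "0 \<le> expectation (\<lambda>\<omega>. D \<omega> \<bullet> (G *v D \<omega>))" by (intro Bochner_Integration.integral_nonneg G_nonneg)
    have "cost X (\<pi>' \<circ> X) \<le> cost ?X (\<pi> \<circ> ?X)"
      using sol wit feasible X_wit unfolding stationary_solution_def by blast
    then have le: "expectation (\<lambda>\<omega>. D \<omega> \<bullet> (G *v D \<omega>)) + g x u \<le> g (xs + xt) (us + ut)"
      using w0(6) star_cost[OF X_wit] by (simp add: x_def u_def D_def)
    note m = means[OF w0(5), folded x_def u_def]
    \<comment> \<open>Equality of the costs forces equality in both lower bounds: first for the mean, then for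
      the deviation \<open>D\<close> of the feedback from the optimal gain.\<close>
    have "\<alpha> ((norm (x - (xs + xt)))\<^sup>2) \<le> 0" using le m D_nonneg by linarith
    then have x_eq: "x = xs + xt"
      using class_K_inf_pos[OF \<alpha>, of "(norm (x - (xs + xt)))\<^sup>2"] by fastforce
    have "expectation (\<lambda>\<omega>. D \<omega> \<bullet> (G *v D \<omega>)) = 0"
      using le m D_nonneg \<alpha>_nonneg[of "norm (x - (xs + xt))"] by linarith
    then have "AE \<omega> in M. D \<omega> \<bullet> (G *v D \<omega>) = 0"
      using integral_nonneg_eq_0_iff_AE[OF L2_integrable_quadratic[OF D_L2, of G]] G_nonneg by simp
    then have D0: "AE \<omega> in M. D \<omega> = 0"
      by eventually_elim (metis G_pos less_irrefl)
    \<comment> \<open>The fluctuation of this solution is now a stationary solution of the same closed-loop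
      recursion as \<open>X_hat\<close>.\<close>
    let ?Y = "\<lambda>\<omega>. X \<omega> - x"
    have Y_L2: "?Y \<in> L2 M M" using w0(1) by (intro L2_intros)
    note [measurable] = L2D(2)[OF w0(1)] L2D(2)[OF w0(2)] L2D(2)[OF w0(3)] L2D(2)[OF Y_L2] L2D(2)[OF Xh(1)] L2D(2)[OF W(1)]
    have [measurable]: "\<pi>' \<in> borel_measurable borel" using \<pi>' by (simp add: feedbacks_def)
    have "distr M borel (\<lambda>\<omega>. F *v ?Y \<omega> + N (V \<omega>))
        = distr M borel (\<lambda>\<omega>. (A *v X \<omega> + B *v (\<pi>' \<circ> X) \<omega> + N (V \<omega>) + d) + (- x))"
    proof (rule distr_cong_AE)
      show "AE \<omega> in M. F *v ?Y \<omega> + N (V \<omega>) = (A *v X \<omega> + B *v (\<pi>' \<circ> X) \<omega> + N (V \<omega>) + d) + (- x)"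
        using D0
      proof eventually_elim
        case (elim \<omega>)
        then have "K *v ?Y \<omega> = (\<pi>' \<circ> X) \<omega> - u" by (simp add: D_def)
        then have "F *v ?Y \<omega> = A *v X \<omega> + B *v (\<pi>' \<circ> X) \<omega> + d - (A *v x + B *v u + d)"
          unfolding F_eq by (simp add: matrix_vector_mult_diff_distrib)
        then show ?case
          unfolding w0(5)[folded x_def u_def] by simp
      qed
    qed simp_all
    also have "\<dots> = distr (distr M borel X) borel (\<lambda>y. y + (- x))"
      by (subst law_shift) (simp_all only: w0(7), measurable)
    also have "\<dots> = distr M borel ?Y"
      using law_shift[OF L2D(2)[OF w0(1)], of "- x"] by simp
    finally have stat_Y: "distr M borel (\<lambda>\<omega>. F *v ?Y \<omega> + N (V \<omega>)) = distr M borel ?Y" .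
    have stat_hat: "distr M borel (\<lambda>\<omega>. F *v X_hat 0 \<omega> + N (W 0 \<omega>)) = distr M borel (X_hat 0)"
    proof -
      have "distr M borel (\<lambda>\<omega>. F *v X_hat 0 \<omega> + N (W 0 \<omega>)) = distr M borel (X_hat 1)"
        using Xh(3)[of 0] by (intro distr_cong_AE) auto
      then show ?thesis using \<rho>_hat(3) by simp
    qed
    have ind_hat: "indep_var borel (X_hat 0) borel (\<lambda>\<omega>. N (W 0 \<omega>))"
      using witness_indep[OF X_wit, of "\<lambda>x. x - (xs + xt)"] by simp
    have "distr M borel ?Y = distr M borel (X_hat 0)"
    proof (rule stationary_law_unique[OF decay(3,1,2) Y_L2 Xh(1) _ ind_hat _ stat_Y stat_hat])
      show "indep_var borel ?Y borel (\<lambda>\<omega>. N (V \<omega>))"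
        using witness_indep[OF wit, of "\<lambda>y. y - x"] by simp
      show "distr M borel (\<lambda>\<omega>. N (V \<omega>)) = distr M borel (\<lambda>\<omega>. N (W 0 \<omega>))"
        using noise(4)[OF w0(3,4)] noise(4)[OF W] by simp
    qed
    then have "distr M borel (\<lambda>\<omega>. ?Y \<omega> + x) = \<rho>_star"
      unfolding law_shift[OF L2D(2)[OF Y_L2]] \<rho>_star_shift using \<rho>_hat(3) x_eq by metis
    then show ?thesis using wit by (simp add: stationary_witness_def)
  qed
  show ?thesis
    using opt unique unfolding f_def cost_def \<pi>_def[abs_def] by blast
qed

end
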